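(* Let $\rho\in(0,1]$. The property of being a $\rho$-DAG admits a size-oblivious two-sided error tester with query complexity $\widetilde O\!\left(\rho^{12}\varepsilon^{-8}\right)$ whenever $0<\varepsilon\le\rho^2/8$. For arbitrary $\varepsilon>0$, the query complexity is $\widetilde O\!\left(\rho^{12}\min\{\varepsilon,\rho^2\}^{-8}\right)$.
   Context: A digraph is a finite vertex set with one binary relation (the set of arcs), with no symmetry requirement. A digraph $D$ on $n$ vertices is a $\rho$-DAG if it contains an induced acyclic subdigraph on at least $\rho n$ vertices. Distance between digraphs on the same $n$-element vertex set is the size of the symmetric difference of their arc sets divided by $n^2$; $D$ is $\varepsilon$-far from a property if its distance to every digraph with the property on the same vertex set exceeds $\varepsilon$. (Since acyclicity is monotone under deletion of arcs, $D$ is $\varepsilon$-far from being a $\rho$-DAG exactly when, for every $S\subseteq V(D)$ with $|S|=\lceil\rho n\rceil$, more than $\varepsilon n^2$ arcs must be deleted from $D[S]$ to make it acyclic.) A size-oblivious two-sided error tester is a randomized algorithm which, given $\varepsilon$ but not $n$, obtains uniformly random vertex labels from a sampling oracle (a request for a sample larger than the input being interpreted as a request to inspect the whole input) and may query whether a given ordered pair of sampled vertices is an arc; it accepts every digraph with the property with probability at least $2/3$ and rejects every digraph $\varepsilon$-far from the property with probability at least $2/3$. Its query complexity is the maximum number of arc queries, bounded independently of $n$. $\widetilde O(\cdot)$ hides polylogarithmic factors (in $1/\varepsilon$ and $1/\rho$). *)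

theory Defs
  imports
    "HOL-Probability.Probability"
    "Graph_Theory.Pair_Digraph"
    "Graph_Theory.Digraph_Component"
begin

text \<open>
  A digraph is a \<^typ>\<open>'v pair_pre_digraph\<close> satisfying \<^const>\<open>pair_fin_digraph\<close>: a finite vertex
  set with an arbitrary relation on it. Loops are arcs, and a loop is a cycle.
\<close>

definition rho_dag :: "real \<Rightarrow> 'v pair_pre_digraph \<Rightarrow> bool" where
  "rho_dag \<rho> D \<longleftrightarrow>
     (\<exists>S\<subseteq>pverts D. \<rho> * real (card (pverts D)) \<le> real (card S) \<and>
        acyclic (arcs_ends (with_proj D \<restriction> S)))"

text \<open>Meaningful only for digraphs with the same vertex set.\<close>

definition digraph_dist :: "'v pair_pre_digraph \<Rightarrow> 'v pair_pre_digraph \<Rightarrow> real" where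
  "digraph_dist D D' =
     real (card (sym_diff (parcs D) (parcs D'))) / (real (card (pverts D)))\<^sup>2"

definition eps_far :: "('v pair_pre_digraph \<Rightarrow> bool) \<Rightarrow> real \<Rightarrow> 'v pair_pre_digraph \<Rightarrow> bool" where
  "eps_far P \<epsilon> D \<longleftrightarrow>
     (\<forall>D'. pair_fin_digraph D' \<and> pverts D' = pverts D \<and> P D' \<longrightarrow> digraph_dist D D' > \<epsilon>)"

text \<open>
  An adaptive randomized procedure interacting with an unknown digraph whose vertices are labelled
  by elements of \<^typ>\<open>'v\<close>. It has no input besides the oracle answers; in particular it is not given
  the number of vertices. \<open>Toss p k\<close> draws private randomness from \<open>p\<close>, \<open>Sample s k\<close> requests
  \<open>s\<close> vertex labels, and \<open>Query u v k\<close> asks whether \<open>(u, v)\<close> is an arc.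
\<close>

datatype 'v procedure =
    Decide bool
  | Toss "nat pmf" "nat \<Rightarrow> 'v procedure"
  | Sample nat "'v list \<Rightarrow> 'v procedure"
  | Query 'v 'v "bool \<Rightarrow> 'v procedure"

text \<open>
  The answer to one request consists of \<open>s\<close> distinct labels in uniformly random order; if \<open>s\<close> exceeds
  the number of vertices, it is the whole vertex set (recognizable by its being shorter than \<open>s\<close>).
  Distinct requests are answered independently, so independent labels with repetition are obtained
  by repeated requests of size 1. Arcs are not revealed by an answer: even after the whole vertex
  set has been returned, reading an arc costs a query.
\<close>

definition sample_vertices :: "'v pair_pre_digraph \<Rightarrow> nat \<Rightarrow> 'v list pmf" where
  "sample_vertices D s =
     pmf_of_set {vs. set vs \<subseteq> pverts D \<and> distinct vs \<and> length vs = min s (card (pverts D))}"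

text \<open>The joint distribution of the verdict (\<^const>\<open>True\<close> is acceptance) and the number of queries.\<close>

primrec run :: "'v pair_pre_digraph \<Rightarrow> 'v procedure \<Rightarrow> (bool \<times> nat) pmf" where
  "run D (Decide b) = return_pmf (b, 0)"
| "run D (Toss p k) = bind_pmf p (\<lambda>x. run D (k x))"
| "run D (Sample s k) = bind_pmf (sample_vertices D s) (\<lambda>vs. run D (k vs))"
| "run D (Query u v k) = map_pmf (\<lambda>(b, q). (b, Suc q)) (run D (k ((u, v) \<in> parcs D)))"

text \<open>Starting with the labels in \<open>S\<close>, only pairs of previously sampled vertices are queried.\<close>

primrec queries_sampled :: "'v pair_pre_digraph \<Rightarrow> 'v set \<Rightarrow> 'v procedure \<Rightarrow> bool" where
  "queries_sampled D S (Decide b) \<longleftrightarrow> True"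
| "queries_sampled D S (Toss p k) \<longleftrightarrow> (\<forall>x\<in>set_pmf p. queries_sampled D S (k x))"
| "queries_sampled D S (Sample s k) \<longleftrightarrow>
     (\<forall>vs\<in>set_pmf (sample_vertices D s). queries_sampled D (S \<union> set vs) (k vs))"
| "queries_sampled D S (Query u v k) \<longleftrightarrow>
     u \<in> S \<and> v \<in> S \<and> queries_sampled D S (k ((u, v) \<in> parcs D))"

text \<open>At most \<open>m\<close> labels are requested in total.\<close>

primrec requests_le :: "'v pair_pre_digraph \<Rightarrow> nat \<Rightarrow> 'v procedure \<Rightarrow> bool" where
  "requests_le D m (Decide b) \<longleftrightarrow> True"
| "requests_le D m (Toss p k) \<longleftrightarrow> (\<forall>x\<in>set_pmf p. requests_le D m (k x))"
| "requests_le D m (Sample s k) \<longleftrightarrow>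
     s \<le> m \<and> (\<forall>vs\<in>set_pmf (sample_vertices D s). requests_le D (m - s) (k vs))"
| "requests_le D m (Query u v k) \<longleftrightarrow> requests_le D m (k ((u, v) \<in> parcs D))"

text \<open>
  The requests must be bounded independently of the digraph. Otherwise, with labels in \<^typ>\<open>nat\<close>, a
  procedure could sample one label \<open>v\<close>, request \<open>100 * v + 101\<close> further ones, and, since at most
  \<open>x\<close> labels are below \<open>x\<close>, very likely obtain the whole vertex set and hence its size.
\<close>

definition size_oblivious :: "'v procedure \<Rightarrow> bool" where
  "size_oblivious A \<longleftrightarrow> (\<exists>m. \<forall>D. pair_fin_digraph D \<longrightarrow> requests_le D m A)"

definition two_sided_tester ::
    "('v pair_pre_digraph \<Rightarrow> bool) \<Rightarrow> real \<Rightarrow> 'v procedure \<Rightarrow> bool" where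
  "two_sided_tester P \<epsilon> A \<longleftrightarrow>
     (\<forall>D. pair_fin_digraph D \<longrightarrow>
        queries_sampled D {} A \<and>
        (P D \<longrightarrow> measure_pmf.prob (run D A) {(b, q). b} \<ge> 2 / 3) \<and>
        (eps_far P \<epsilon> D \<longrightarrow> measure_pmf.prob (run D A) {(b, q). \<not> b} \<ge> 2 / 3))"

definition query_complexity_le :: "'v procedure \<Rightarrow> real \<Rightarrow> bool" where
  "query_complexity_le A c \<longleftrightarrow>
     (\<forall>D. pair_fin_digraph D \<longrightarrow> (\<forall>(b, q)\<in>set_pmf (run D A). real q \<le> c))"

text \<open>
  \<open>P\<close> has a size-oblivious two-sided error tester \<open>T\<close> for the proximity parameters in \<open>E\<close>. The
  procedure may depend on the proximity parameter, the bound \<open>c\<close> only on that parameter and not on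
  the number of vertices.
\<close>

definition admits_tester ::
    "('v pair_pre_digraph \<Rightarrow> bool) \<Rightarrow> real set \<Rightarrow> (real \<Rightarrow> real) \<Rightarrow> bool" where
  "admits_tester P E c \<longleftrightarrow>
     (\<exists>T :: real \<Rightarrow> 'v procedure. \<forall>\<epsilon>\<in>E.
        size_oblivious (T \<epsilon>) \<and> two_sided_tester P \<epsilon> (T \<epsilon>) \<and>
        query_complexity_le (T \<epsilon>) (c \<epsilon>))"

text \<open>
  The class of functions of \<open>(\<rho>, \<epsilon>)\<close> that are \<open>f\<close> up to a constant and polylogarithmic factors in
  \<open>1 / \<epsilon>\<close> and \<open>1 / \<rho>\<close>, uniformly on the region \<open>R\<close>. The summand 2 keeps the logarithms
  bounded away from 0 when \<open>\<rho>\<close> or \<open>\<epsilon>\<close> is not small.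
\<close>

definition soft_O :: "(real \<times> real) set \<Rightarrow> (real \<Rightarrow> real \<Rightarrow> real) \<Rightarrow> (real \<Rightarrow> real \<Rightarrow> real) set" where
  "soft_O R f =
     {g. \<exists>(C::real) (k::nat). \<forall>(\<rho>, \<epsilon>)\<in>R.
        \<bar>g \<rho> \<epsilon>\<bar> \<le> C * (ln (2 + 1 / \<epsilon>) + ln (2 + 1 / \<rho>)) ^ k * \<bar>f \<rho> \<epsilon>\<bar>}"

end

theory Submission
  imports Defs
begin

text \<open>
  The tester draws \<open>s\<close> independent uniform vertices, queries all pairs, and accepts if at least
  \<open>(\<rho> - \<delta>) s\<close> of the sample points induce an acyclic subdigraph, where \<open>\<delta> = \<epsilon> / (12 \<rho>)\<close>. Digraphs with
  fewer than about \<open>1 / \<delta>\<close> vertices, where rounding \<open>\<rho> n\<close> matters, are read completely.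

  A \<open>\<rho>\<close>-DAG is accepted because the share of the sample that falls into a fixed large acyclic set
  concentrates.

  A far digraph is rejected by a container argument. An acyclic set \<open>A\<close> has a sink, hence so has its
  intersection with any set that it meets. Suppose a set \<open>C \<supseteq> A\<close> has a nonempty out-core \<open>W\<close>: each vertex
  of \<open>W\<close> has at least \<open>d = \<epsilon> n / (4 \<rho>)\<close> out-neighbours in \<open>W\<close>. If \<open>A\<close> misses \<open>W\<close>, then \<open>W\<close> can be
  removed from \<open>C\<close>; otherwise a sink \<open>w\<close> of \<open>A \<inter> W\<close> is recorded, and its at least \<open>d\<close> out-neighbours in
  \<open>W\<close> can be removed from \<open>C\<close>. Starting with all vertices, \<open>q \<le> \<lceil>4 \<rho> / \<epsilon>\<rceil>\<close> such steps lead to a container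
  without out-core, which is determined by the list of these steps, hence by at most \<open>q\<close> vertices of \<open>A\<close>
  and their positions in the list (\<open>fingerprint_exists\<close>). A set
  without out-core becomes acyclic after few arc deletions (\<open>delete_arcs_if_out_core_empty\<close>), so if the
  digraph is far from being a \<open>\<rho>\<close>-DAG, the final container has density below \<open>\<rho> - 2 \<delta>\<close>
  (\<open>far_imp_core_free_small\<close>).

  Applied to an acyclic part of the sample, the recorded vertices are sample points, so there are at most
  \<open>(s + 1) ^ q\<close> possible fingerprints, independently of \<open>n\<close>. Given the recorded points, the others are still
  independent, and by Chernoff's bound at least \<open>(\<rho> - 3 \<delta> / 2) s\<close> of them fall into the container with
  probability at most \<open>exp (- s \<delta>\<^sup>2 / (16 \<rho>))\<close>. The union bound works as soon as \<open>s\<close> exceeds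
  \<open>q \<rho> / \<delta>\<^sup>2\<close>, which is of order \<open>\<rho> ^ 4 / \<epsilon> ^ 3\<close>, by a logarithmic factor
  (\<open>prob_sample_dense_acyclic_sound\<close>). For \<open>\<epsilon> \<le> \<rho>\<^sup>2 / 8\<close> the number \<open>s\<^sup>2\<close> of queries is then within the
  claimed bound, with a factor \<open>(\<rho>\<^sup>2 / \<epsilon>)\<^sup>2\<close> to spare. For larger \<open>\<epsilon>\<close> the tester for \<open>\<rho>\<^sup>2 / 8\<close> is used.
\<close>

section \<open>Acyclic relations\<close>

lemma rho_dag_iff:
  "rho_dag \<rho> D \<longleftrightarrow>
     (\<exists>S\<subseteq>pverts D. \<rho> * real (card (pverts D)) \<le> real (card S) \<and> acyclic (parcs D \<inter> S \<times> S))"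
proof -
  have "arcs_ends (with_proj D \<restriction> S) = parcs D \<inter> S \<times> S" for S
    by (force simp: arcs_ends_conv)
  then show ?thesis
    by (simp add: rho_dag_def)
qed

lemma acyclic_Un_into_disjoint:
  assumes "acyclic R" and R: "R \<subseteq> C \<times> C" and K: "C \<inter> K = {}"
  shows "acyclic (R \<union> C \<times> K)"
proof -
  have "x \<in> C \<and> (y \<in> K \<or> (x, y) \<in> R\<^sup>+)" if "(x, y) \<in> (R \<union> C \<times> K)\<^sup>+" for x y
    using that
  proof (induction rule: trancl_induct)
    case (base y)
    then show ?case using R by auto
  next
    case (step y z)
    then show ?case using R K by (auto intro: trancl_into_trancl)
  qed
  then show ?thesis
    using assms(1) K unfolding acyclic_def by blast
qed

lemma acyclic_finite_sink:
  assumes "acyclic (E \<inter> A \<times> A)" "finite A" "A \<noteq> {}"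
  obtains w where "w \<in> A" "E `` {w} \<inter> A = {}"
proof -
  have "finite (E \<inter> A \<times> A)"
    using assms(2) by auto
  then have "wf ((E \<inter> A \<times> A)\<inverse>)"
    using assms(1) by (simp add: finite_acyclic_wf_converse)
  then have min: "\<exists>w\<in>A. \<forall>y. (y, w) \<in> (E \<inter> A \<times> A)\<inverse> \<longrightarrow> y \<notin> A"
    unfolding wf_eq_minimal using assms(3) by (metis ex_in_conv)
  from min obtain w where w: "w \<in> A" "\<forall>y. (y, w) \<in> (E \<inter> A \<times> A)\<inverse> \<longrightarrow> y \<notin> A"
    by (elim bexE)
  have "E `` {w} \<inter> A = {}"
    using w by blast
  with w(1) show ?thesis
    by (rule that)
qed

section \<open>Out-cores and containers of acyclic sets\<close>

text \<open>
  The sets \<open>W\<close> in which every vertex has at least \<open>d\<close> out-neighbours are closed under union, so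
  this is the largest such subset of \<open>C\<close>: a directed analogue of the \<open>d\<close>-core of a graph. Being
  the largest makes it a function of \<open>C\<close>, which containers need.
\<close>

definition out_core :: "'v rel \<Rightarrow> real \<Rightarrow> 'v set \<Rightarrow> 'v set" where
  "out_core E d C = \<Union>{W. W \<subseteq> C \<and> (\<forall>w\<in>W. d \<le> real (card (E `` {w} \<inter> W)))}"

lemma out_core_subset: "out_core E d C \<subseteq> C"
  by (auto simp: out_core_def)

lemma out_core_mono: "C \<subseteq> C' \<Longrightarrow> out_core E d C \<subseteq> out_core E d C'"
  unfolding out_core_def by blast

lemma out_core_degree:
  assumes "finite C" and w: "w \<in> out_core E d C"
  shows "d \<le> real (card (E `` {w} \<inter> out_core E d C))"
proof -
  obtain W where W: "W \<subseteq> C" "\<forall>w\<in>W. d \<le> real (card (E `` {w} \<inter> W))" "w \<in> W"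
    using w by (auto simp: out_core_def)
  then have "W \<subseteq> out_core E d C"
    by (auto simp: out_core_def)
  moreover have "finite (out_core E d C)"
    using assms(1) out_core_subset finite_subset by metis
  ultimately have "card (E `` {w} \<inter> W) \<le> card (E `` {w} \<inter> out_core E d C)"
    by (intro card_mono) auto
  then show ?thesis
    using W by fastforce
qed

text \<open>
  If \<open>C\<close> has no out-core, some vertex has fewer than \<open>d\<close> out-neighbours in \<open>C\<close>. Deleting its arcs
  into \<open>C\<close> turns it into a sink, and the other vertices are treated recursively.
\<close>

lemma delete_arcs_if_out_core_empty:
  assumes "finite C" "out_core E d C = {}"
  shows "\<exists>X\<subseteq>C \<times> C. real (card X) \<le> d * real (card C) \<and> acyclic ((E - X) \<inter> C \<times> C)"
  using assms
proof (induction C rule: finite_psubset_induct)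
  case (psubset C)
  show ?case
  proof (cases "C = {}")
    case True
    then show ?thesis by (auto simp: acyclic_def)
  next
    case False
    have "\<not> (\<forall>v\<in>C. d \<le> real (card (E `` {v} \<inter> C)))"
    proof
      assume "\<forall>v\<in>C. d \<le> real (card (E `` {v} \<inter> C))"
      then have "C \<subseteq> out_core E d C"
        by (auto simp: out_core_def)
      then show False using psubset.prems False by auto
    qed
    then obtain v where v: "v \<in> C" "real (card (E `` {v} \<inter> C)) < d"
      by (auto simp: not_le)
    let ?C = "C - {v}"
    have "out_core E d ?C = {}"
      using out_core_mono[of ?C C E d] psubset.prems by auto
    then obtain X where X: "X \<subseteq> ?C \<times> ?C" "real (card X) \<le> d * real (card ?C)"
      "acyclic ((E - X) \<inter> ?C \<times> ?C)"
      using psubset.IH[of ?C] v(1) by auto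
    let ?Y = "{v} \<times> (E `` {v} \<inter> C)"
    have "real (card (X \<union> ?Y)) \<le> real (card X) + real (card ?Y)"
      using card_Un_le[of X ?Y] by linarith
    also have "\<dots> \<le> d * real (card ?C) + d"
      using X(2) v(2) by (simp add: card_cartesian_product)
    also have "\<dots> = d * real (card C)"
      using v(1) psubset.hyps
      by (simp add: card_Diff_singleton card_gt_0_iff of_nat_diff Suc_leI algebra_simps False)
    finally have card: "real (card (X \<union> ?Y)) \<le> d * real (card C)" .
    have "(E - (X \<union> ?Y)) \<inter> C \<times> C \<subseteq> (E - X) \<inter> ?C \<times> ?C \<union> ?C \<times> {v}"
      by auto
    moreover have "acyclic ((E - X) \<inter> ?C \<times> ?C \<union> ?C \<times> {v})"
      by (intro acyclic_Un_into_disjoint X(3)) auto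
    ultimately have "acyclic ((E - (X \<union> ?Y)) \<inter> C \<times> C)"
      by (rule acyclic_subset[rotated])
    moreover have "X \<union> ?Y \<subseteq> C \<times> C"
      using X(1) v(1) by auto
    ultimately show ?thesis
      using card by blast
  qed
qed

text \<open>
  One step of the container construction around an unknown acyclic set \<open>A \<subseteq> C\<close>. The token \<open>None\<close>
  announces that \<open>A\<close> misses the out-core. The token \<open>Some w\<close> announces that \<open>w\<close> is a sink of
  \<open>A\<close> within the out-core, so that \<open>A\<close> avoids the out-neighbours of \<open>w\<close> there. In both cases at
  least \<open>d\<close> vertices outside \<open>A\<close> are discarded, unless the out-core is empty.
\<close>

primrec shrink :: "'v rel \<Rightarrow> real \<Rightarrow> 'v set \<Rightarrow> 'v option \<Rightarrow> 'v set" where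
  "shrink E d C None = C - out_core E d C"
| "shrink E d C (Some w) = C - (E `` {w} \<inter> out_core E d C)"

definition container :: "'v rel \<Rightarrow> real \<Rightarrow> 'v set \<Rightarrow> 'v option list \<Rightarrow> 'v set" where
  "container E d = foldl (shrink E d)"

lemma container_subset: "container E d V \<tau> \<subseteq> V"
proof (induction \<tau> arbitrary: V)
  case Nil
  then show ?case by (simp add: container_def)
next
  case (Cons t \<tau>)
  have "shrink E d V t \<subseteq> V" by (cases t) auto
  then show ?case using Cons[of "shrink E d V t"] by (simp add: container_def)
qed

text \<open>
  Every acyclic set has a container described by \<open>q\<close> tokens naming only members of the set itself.
  Each step with a nonempty out-core costs the container \<open>d\<close> vertices, so \<open>q\<close> steps either exhaust
  \<open>q * d\<close> vertices or reach a container without an out-core; an empty out-core stays empty.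
\<close>

lemma fingerprint_exists:
  assumes "finite C" "A \<subseteq> C" "acyclic (E \<inter> A \<times> A)"
  shows "\<exists>\<tau>. length \<tau> = q \<and> set \<tau> \<subseteq> insert None (Some ` A) \<and> A \<subseteq> container E d C \<tau> \<and>
          (out_core E d (container E d C \<tau>) = {} \<or>
           real q * d \<le> real (card C) - real (card (container E d C \<tau>)))"
  using assms
proof (induction q arbitrary: C)
  case 0
  show ?case by (intro exI[of _ "[]"]) (use 0 in \<open>auto simp: container_def\<close>)
next
  case (Suc q)
  let ?K = "out_core E d C"
  have fin: "finite ?K" "finite (A \<inter> ?K)"
    using Suc.prems(1) out_core_subset[of E d C] by (auto intro: finite_subset)
  have deg: "d \<le> real (card (E `` {w} \<inter> ?K))" if "w \<in> ?K" for w
    using out_core_degree[OF Suc.prems(1) that] .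
  have "\<exists>t. t \<in> insert None (Some ` A) \<and> A \<subseteq> shrink E d C t \<and>
          (?K = {} \<and> shrink E d C t = C \<or> d \<le> real (card C) - real (card (shrink E d C t)))"
  proof -
    have diff: "d \<le> real (card C) - real (card (C - Z))"
      if "Z \<subseteq> C" "d \<le> real (card Z)" for Z
      using that Suc.prems(1) by (simp add: card_Diff_subset finite_subset card_mono of_nat_diff)
    show ?thesis
    proof (cases "A \<inter> ?K = {}")
      case empty: True
      have "d \<le> real (card ?K)" if ne: "?K \<noteq> {}"
      proof -
        obtain w where "w \<in> ?K" using ne by auto
        then show ?thesis
          using deg[of w] card_mono[OF fin(1), of "E `` {w} \<inter> ?K"] by fastforce
      qed
      then have "?K = {} \<or> d \<le> real (card C) - real (card (C - ?K))"
        using diff[OF out_core_subset] by auto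
      then show ?thesis
        using Suc.prems(2) empty by (intro exI[of _ None]) auto
    next
      case False
      have "acyclic (E \<inter> (A \<inter> ?K) \<times> (A \<inter> ?K))"
        by (rule acyclic_subset[OF Suc.prems(3)]) auto
      then obtain w where w: "w \<in> A \<inter> ?K" "E `` {w} \<inter> (A \<inter> ?K) = {}"
        using acyclic_finite_sink fin(2) False by metis
      then have "d \<le> real (card C) - real (card (C - (E `` {w} \<inter> ?K)))"
        using out_core_subset[of E d C] deg[of w] by (intro diff) auto
      then show ?thesis
        using w Suc.prems(2) by (intro exI[of _ "Some w"]) auto
    qed
  qed
  then obtain t where t: "t \<in> insert None (Some ` A)" "A \<subseteq> shrink E d C t"
    "?K = {} \<and> shrink E d C t = C \<or> d \<le> real (card C) - real (card (shrink E d C t))"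
    by blast
  let ?C = "shrink E d C t"
  have C: "?C \<subseteq> C" by (cases t) auto
  then have "finite ?C" using Suc.prems(1) finite_subset by blast
  then obtain \<tau> where \<tau>: "length \<tau> = q" "set \<tau> \<subseteq> insert None (Some ` A)" "A \<subseteq> container E d ?C \<tau>"
    "out_core E d (container E d ?C \<tau>) = {} \<or>
     real q * d \<le> real (card ?C) - real (card (container E d ?C \<tau>))"
    using Suc.IH[of ?C] t(2) Suc.prems(3) by blast
  have cont: "container E d C (t # \<tau>) = container E d ?C \<tau>"
    by (simp add: container_def)
  have "out_core E d (container E d ?C \<tau>) = {} \<or>
     real (Suc q) * d \<le> real (card C) - real (card (container E d ?C \<tau>))"
  proof (cases "?K = {} \<and> ?C = C")
    case True
    then show ?thesis
      using out_core_mono[OF container_subset, of E d E d C \<tau>] by auto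
  next
    case False
    then show ?thesis using t(3) \<tau>(4) by (auto simp: algebra_simps)
  qed
  then show ?case
    using \<tau> t cont by (intro exI[of _ "t # \<tau>"]) auto
qed

text \<open>
  If \<open>D\<close> is far from having a dense acyclic set, then final containers fall short of density \<open>\<rho>\<close> by
  a definite margin. Otherwise bring \<open>C\<close> to size \<open>\<lceil>\<rho> n\<rceil>\<close>, by dropping vertices or by adding a set \<open>K\<close>
  of at most \<open>2 \<delta> n + 1\<close> vertices. Making the part inside \<open>C\<close> acyclic and deleting all arcs
  from \<open>K\<close> into the resulting set costs at most \<open>\<epsilon> n\<^sup>2 / 2\<close> arcs each. The bound \<open>1 \<le> \<delta> n\<close> absorbs the rounding of
  \<open>\<rho> n\<close>; in smaller digraphs a maximum acyclic set may miss the size \<open>\<rho> n\<close> by less than one vertex, and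
  the claim can fail.
\<close>

lemma far_imp_core_free_small:
  fixes D :: "'v pair_pre_digraph"
  assumes D: "pair_fin_digraph D" and far: "eps_far (rho_dag \<rho>) \<epsilon> D"
    and \<rho>: "0 < \<rho>" "\<rho> \<le> 1" and \<epsilon>: "0 < \<epsilon>" "\<epsilon> \<le> \<rho>\<^sup>2"
    and \<delta>: "\<delta> = \<epsilon> / (12 * \<rho>)" and n: "n = real (card (pverts D))" "1 \<le> \<delta> * n"
    and C: "C \<subseteq> pverts D" "out_core (parcs D) (\<epsilon> * n / (4 * \<rho>)) C = {}"
  shows "real (card C) < (\<rho> - 2 * \<delta>) * n"
proof (rule ccontr)
  assume "\<not> ?thesis"
  then have large: "(\<rho> - 2 * \<delta>) * n \<le> real (card C)" by simp
  interpret pair_fin_digraph D by (rule D)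
  let ?V = "pverts D"
  let ?d = "\<epsilon> * n / (4 * \<rho>)"
  define m where "m = nat \<lceil>\<rho> * n\<rceil>"
  have n0: "n \<ge> 0" using n by simp
  have m: "\<rho> * n \<le> real m" "real m \<le> \<rho> * n + 1"
    unfolding m_def using \<rho> n0 by (auto simp: of_nat_nat intro: mult_nonneg_nonneg)
  have "\<delta> \<le> \<rho>"
    using \<rho> \<epsilon> unfolding \<delta> by (simp add: field_simps power2_eq_square)
  then have "\<delta> * n \<le> \<rho> * n"
    using n0 by (rule mult_right_mono)
  with n(2) have rn: "1 \<le> \<rho> * n" by linarith
  have "\<rho> * n \<le> n" using \<rho> n0 by (simp add: mult_left_le_one_le)
  then have mV: "m \<le> card ?V"
    unfolding m_def n(1) by (simp add: nat_le_iff ceiling_le_iff)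
  have finC: "finite C" using C(1) pair_finite_verts finite_subset by blast
  obtain R where R: "R \<subseteq> C" "card R = min m (card C)"
    using ex_card[of "min m (card C)" C] by auto
  have finR: "finite R" using R(1) finC finite_subset by blast
  have "m - card R \<le> card (?V - R)"
    using mV R(1) C(1) finR by (subst card_Diff_subset) auto
  then obtain K where K: "K \<subseteq> ?V - R" "card K = m - card R"
    using ex_card by blast
  have finK: "finite K" using K(1) pair_finite_verts finite_subset by blast
  let ?S = "R \<union> K"
  have cardS: "card ?S = m"
    using K R finR finK by (subst card_Un_disjoint) auto
  have cardK: "real (card K) \<le> 3 * (\<delta> * n)"
  proof (cases "m \<le> card C")
    case True
    then show ?thesis using K(2) R(2) n by simp
  next
    case False
    then have "real (card K) = real m - real (card C)"
      using K(2) R(2) by (simp add: of_nat_diff)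
    then show ?thesis using large m(2) n(2) by (simp add: algebra_simps)
  qed
  have core: "out_core (parcs D) ?d R = {}"
    using out_core_mono[OF R(1), of "parcs D" ?d] C(2) by simp
  obtain X where X: "X \<subseteq> R \<times> R" "real (card X) \<le> ?d * real (card R)"
    "acyclic ((parcs D - X) \<inter> R \<times> R)"
    using delete_arcs_if_out_core_empty[OF finR core] by blast
  let ?X = "X \<union> K \<times> ?S"
  let ?D = "\<lparr>pverts = ?V, parcs = parcs D - ?X\<rparr>"
  have "pair_fin_digraph ?D"
    by unfold_locales (auto simp: wellformed' pair_finite_verts pair_finite_arcs)
  moreover have "rho_dag \<rho> ?D"
  proof -
    have "acyclic ((parcs D - X) \<inter> R \<times> R \<union> R \<times> K)"
      using K(1) by (intro acyclic_Un_into_disjoint X(3)) auto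
    then have "acyclic (parcs ?D \<inter> ?S \<times> ?S)"
      by (rule acyclic_subset) auto
    moreover have "?S \<subseteq> pverts ?D" using R(1) C(1) K(1) by auto
    moreover have "\<rho> * real (card (pverts ?D)) \<le> real (card ?S)"
      unfolding cardS using m(1) n(1) by simp
    ultimately show ?thesis unfolding rho_dag_iff by blast
  qed
  ultimately have "digraph_dist D ?D > \<epsilon>"
    using far unfolding eps_far_def by simp
  moreover have "real (card (sym_diff (parcs D) (parcs ?D))) \<le> \<epsilon> * n\<^sup>2"
  proof -
    have fin: "finite X" "finite (K \<times> ?S)"
      using X(1) finR finK finite_subset by auto
    have "sym_diff (parcs D) (parcs ?D) \<subseteq> X \<union> K \<times> ?S" by auto
    then have "card (sym_diff (parcs D) (parcs ?D)) \<le> card (X \<union> K \<times> ?S)"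
      by (intro card_mono) (use fin in auto)
    also have "\<dots> \<le> card X + card (K \<times> ?S)"
      by (rule card_Un_le)
    also have "card (K \<times> ?S) = card K * m"
      by (simp only: card_cartesian_product cardS)
    finally have "real (card (sym_diff (parcs D) (parcs ?D))) \<le> real (card X) + real (card K) * real m"
      by (metis of_nat_add of_nat_le_iff of_nat_mult)
    also have "\<dots> \<le> ?d * real m + real (card K) * real m"
    proof -
      have "?d * real (card R) \<le> ?d * real m"
        using R(2) \<rho> \<epsilon> n0 by (intro mult_left_mono) auto
      then show ?thesis using X(2) by linarith
    qed
    also have "\<dots> = (?d + real (card K)) * real m"
      by (simp add: algebra_simps)
    also have "\<dots> \<le> (?d + 3 * (\<delta> * n)) * (2 * (\<rho> * n))"
      using cardK m rn \<rho> \<epsilon> n0 by (intro mult_mono add_left_mono add_nonneg_nonneg) (auto simp: \<delta>)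
    also have "\<dots> = \<epsilon> * n\<^sup>2"
      using \<rho> unfolding \<delta> by (simp add: field_simps power2_eq_square)
    finally show ?thesis .
  qed
  moreover have "n > 0" using rn \<rho> n0 by (cases "n = 0") auto
  ultimately show False
    unfolding digraph_dist_def n(1)[symmetric] by (simp add: divide_simps)
qed

section \<open>Tail bounds for independent samples\<close>

lemma prob_bind_pmf_ge:
  assumes "\<And>x. x \<in> set_pmf p \<Longrightarrow> b \<le> measure_pmf.prob (f x) E"
  shows "b \<le> measure_pmf.prob (bind_pmf p f) E"
proof -
  have "ennreal b = (\<integral>\<^sup>+x. ennreal b \<partial>measure_pmf p)"
    by simp
  also have "\<dots> \<le> (\<integral>\<^sup>+x. emeasure (measure_pmf (f x)) E \<partial>measure_pmf p)"
    by (intro nn_integral_mono_AE)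
       (auto simp: AE_measure_pmf_iff measure_pmf.emeasure_eq_measure intro!: ennreal_leI assms)
  also have "\<dots> = ennreal (measure_pmf.prob (bind_pmf p f) E)"
    by (simp add: measure_pmf.emeasure_eq_measure[symmetric])
  finally show ?thesis
    by (simp add: ennreal_le_iff)
qed

lemma prob_bind_pmf_le:
  assumes "\<And>x. x \<in> set_pmf p \<Longrightarrow> measure_pmf.prob (f x) E \<le> b"
  shows "measure_pmf.prob (bind_pmf p f) E \<le> b"
proof -
  have compl: "measure_pmf.prob q (- E) = 1 - measure_pmf.prob q E" for q :: "'b pmf"
    using measure_pmf.prob_compl[of E q] by (simp add: Compl_eq_Diff_UNIV)
  have "1 - b \<le> measure_pmf.prob (bind_pmf p f) (- E)"
    by (intro prob_bind_pmf_ge) (use assms in \<open>auto simp: compl\<close>)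
  then show ?thesis
    by (simp add: compl)
qed

text \<open>
  A bound that holds for every fixed outcome on the coordinates in \<open>J\<close>, with only the other
  coordinates random, holds for all of them together. This makes a container that is determined by a few
  sample points independent of the remaining ones.
\<close>

lemma prob_Pi_pmf_le_conditional:
  assumes "finite S" "J \<subseteq> S"
    and "\<And>f. measure_pmf.prob (Pi_pmf (S - J) dflt p) {g. (\<lambda>i. if i \<in> J then f i else g i) \<in> E} \<le> b"
  shows "measure_pmf.prob (Pi_pmf S dflt p) E \<le> b"
proof -
  have "Pi_pmf S dflt p = Pi_pmf (J \<union> (S - J)) dflt p"
    using assms(2) by (simp add: Un_absorb1)
  also have "\<dots> = bind_pmf (Pi_pmf J dflt p)
      (\<lambda>f. map_pmf (\<lambda>g i. if i \<in> J then f i else g i) (Pi_pmf (S - J) dflt p))"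
    using assms(1,2) finite_subset
    by (subst Pi_pmf_union) (auto simp: pair_pmf_def map_bind_pmf map_pmf_def bind_assoc_pmf bind_return_pmf)
  finally have eq: "Pi_pmf S dflt p = \<dots>" .
  show ?thesis
    unfolding eq by (rule prob_bind_pmf_le) (use assms(3) in \<open>simp add: vimage_def\<close>)
qed

lemma expectation_power_card:
  fixes p :: "'v pmf" and B :: "'i set"
  assumes B: "finite B" and w: "0 \<le> w"
  shows "measure_pmf.expectation (Pi_pmf B dflt (\<lambda>_. p)) (\<lambda>f. w ^ card {i\<in>B. f i \<in> A}) =
           (1 + (w - 1) * measure_pmf.prob p A) ^ card B"
proof -
  let ?h = "\<lambda>v. 1 + (w - 1) * indicator A v :: real"
  have h: "?h v = (if v \<in> A then w else 1)" for v
    by simp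
  have "w ^ card {i\<in>B. f i \<in> A} = (\<Prod>i\<in>B. ?h (f i))" for f :: "'i \<Rightarrow> 'v"
    unfolding h using B by (simp add: prod.If_cases Int_def)
  moreover have int: "integrable (measure_pmf p) ?h"
    by (intro measure_pmf.integrable_const_bound[where B = "max w 1"]) (use w in \<open>auto simp: indicator_def\<close>)
  ultimately have "measure_pmf.expectation (Pi_pmf B dflt (\<lambda>_. p)) (\<lambda>f. w ^ card {i\<in>B. f i \<in> A}) =
      (\<Prod>i\<in>B. measure_pmf.expectation p ?h)"
    using B w by (subst expectation_prod_Pi_pmf[symmetric]) (auto simp: indicator_def)
  also have "measure_pmf.expectation p ?h = 1 + (w - 1) * measure_pmf.prob p A"
  proof -
    have "integrable (measure_pmf p) (indicator A :: 'v \<Rightarrow> real)"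
      by (intro measure_pmf.integrable_const_bound[where B = 1]) auto
    then show ?thesis
      by (simp add: Bochner_Integration.integral_add)
  qed
  finally show ?thesis
    by simp
qed

text \<open>
  The exponential moment method: Markov's inequality for \<open>w\<close> raised to the number of hits. Taking
  \<open>w > 1\<close> bounds the upper tail and \<open>w < 1\<close> the lower tail.
\<close>

lemma prob_count_le_exp:
  fixes p :: "'v pmf" and B :: "'i set"
  assumes B: "finite B" and w: "0 < w" and a: "0 < a"
  shows "measure_pmf.prob (Pi_pmf B dflt (\<lambda>_. p)) {f. a \<le> w ^ card {i\<in>B. f i \<in> A}} \<le>
           exp ((w - 1) * measure_pmf.prob p A * real (card B)) / a"
proof -
  let ?M = "Pi_pmf B dflt (\<lambda>_. p)"
  let ?X = "\<lambda>f. w ^ card {i\<in>B. f i \<in> A}"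
  let ?y = "(w - 1) * measure_pmf.prob p A"
  have "?X f \<le> max 1 w ^ card B" for f :: "'i \<Rightarrow> 'v"
  proof -
    have "?X f \<le> max 1 w ^ card {i\<in>B. f i \<in> A}"
      using w by (intro power_mono) auto
    also have "\<dots> \<le> max 1 w ^ card B"
      using B by (intro power_increasing card_mono) auto
    finally show ?thesis .
  qed
  then have int: "integrable (measure_pmf ?M) ?X"
    using w by (intro measure_pmf.integrable_const_bound[where B = "max 1 w ^ card B"]) auto
  have "measure_pmf.prob ?M {f \<in> space ?M. a \<le> ?X f} \<le> measure_pmf.expectation ?M ?X / a"
    by (rule integral_Markov_inequality_measure[where A = "{}"]) (use int w a in auto)
  also have "measure_pmf.expectation ?M ?X = (1 + ?y) ^ card B"
    by (rule expectation_power_card[OF B]) (use w in simp)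
  also have "\<dots> \<le> exp ?y ^ card B"
  proof (intro power_mono)
    have "(1 - w) * measure_pmf.prob p A \<le> 1"
      using w by (cases "w \<le> 1") (auto intro!: mult_le_one intro: order_trans[OF mult_nonpos_nonneg])
    then show "0 \<le> 1 + ?y"
      by (simp add: algebra_simps)
  qed (rule exp_ge_add_one_self)
  also have "\<dots> = exp (?y * real (card B))"
    by (simp add: exp_of_nat_mult mult.commute)
  finally show ?thesis
    using a by (simp add: divide_right_mono)
qed

text \<open>
  The multiplicative form of the Chernoff bound matters: the resulting rate is of order
  \<open>\<delta>\<^sup>2 / \<rho>\<close> for deviations \<open>\<delta>\<close> from density \<open>\<rho>\<close>, whereas an additive (Hoeffding) bound would only
  give \<open>\<delta>\<^sup>2\<close> and lose a factor \<open>1 / \<rho>\<close> in the sample size.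
\<close>

lemma prob_count_upper_tail:
  assumes B: "finite B" "real (card B) \<le> s" and A: "measure_pmf.prob p A \<le> \<mu>"
    and t: "0 \<le> t" "t \<le> 1" and a: "0 \<le> a"
  shows "measure_pmf.prob (Pi_pmf B dflt (\<lambda>_. p)) {f. a \<le> real (card {i\<in>B. f i \<in> A})} \<le>
           exp (t * \<mu> * s - a * (t - t\<^sup>2))"
proof -
  let ?M = "Pi_pmf B dflt (\<lambda>_. p)"
  have ln: "t - t\<^sup>2 \<le> ln (1 + t)"
    using t by (rule ln_one_plus_pos_lower_bound)
  have "0 \<le> \<mu>"
    using A measure_nonneg order_trans by blast
  have pow: "exp (a * (t - t\<^sup>2)) \<le> (1 + t) ^ k" if "a \<le> real k" for k
  proof -
    have "a * (t - t\<^sup>2) \<le> real k * ln (1 + t)"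
      using that ln a t by (intro mult_mono) (auto simp: power2_eq_square mult_left_le)
    then have "exp (a * (t - t\<^sup>2)) \<le> exp (real k * ln (1 + t))"
      by simp
    also have "\<dots> = (1 + t) ^ k"
      using t by (simp add: exp_of_nat_mult)
    finally show ?thesis .
  qed
  have "measure_pmf.prob ?M {f. a \<le> real (card {i\<in>B. f i \<in> A})} \<le>
        measure_pmf.prob ?M {f. exp (a * (t - t\<^sup>2)) \<le> (1 + t) ^ card {i\<in>B. f i \<in> A}}"
    by (intro measure_pmf.finite_measure_mono) (use pow in auto)
  also have "\<dots> \<le> exp ((1 + t - 1) * measure_pmf.prob p A * real (card B)) / exp (a * (t - t\<^sup>2))"
    using B t by (intro prob_count_le_exp) auto
  also have "\<dots> \<le> exp (t * \<mu> * s) / exp (a * (t - t\<^sup>2))"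
    using B A t \<open>0 \<le> \<mu>\<close> by (intro divide_right_mono) (auto intro!: mult_mono)
  finally show ?thesis
    by (simp add: exp_diff)
qed

lemma prob_count_lower_tail:
  assumes B: "finite B" and A: "\<mu> \<le> measure_pmf.prob p A"
    and t: "0 \<le> t" "t \<le> 1 / 2"
  shows "measure_pmf.prob (Pi_pmf B dflt (\<lambda>_. p)) {f. real (card {i\<in>B. f i \<in> A}) \<le> a} \<le>
           exp (a * (t + 2 * t\<^sup>2) - t * \<mu> * real (card B))"
proof -
  let ?M = "Pi_pmf B dflt (\<lambda>_. p)"
  have ln: "- t - 2 * t\<^sup>2 \<le> ln (1 - t)"
    using t by (rule ln_one_minus_pos_lower_bound)
  have pow: "exp (- a * (t + 2 * t\<^sup>2)) \<le> (1 - t) ^ k" if "real k \<le> a" for k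
  proof -
    have "- a * (t + 2 * t\<^sup>2) \<le> - real k * (t + 2 * t\<^sup>2)"
      using that t by (intro mult_right_mono) auto
    also have "\<dots> = real k * (- t - 2 * t\<^sup>2)"
      by (simp add: algebra_simps)
    also have "\<dots> \<le> real k * ln (1 - t)"
      using ln by (intro mult_left_mono) auto
    finally have "exp (- a * (t + 2 * t\<^sup>2)) \<le> exp (real k * ln (1 - t))"
      by simp
    also have "\<dots> = (1 - t) ^ k"
      using t by (simp add: exp_of_nat_mult)
    finally show ?thesis .
  qed
  have "measure_pmf.prob ?M {f. real (card {i\<in>B. f i \<in> A}) \<le> a} \<le>
        measure_pmf.prob ?M {f. exp (- a * (t + 2 * t\<^sup>2)) \<le> (1 - t) ^ card {i\<in>B. f i \<in> A}}"
    by (intro measure_pmf.finite_measure_mono) (use pow in auto)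
  also have "\<dots> \<le> exp ((1 - t - 1) * measure_pmf.prob p A * real (card B)) / exp (- a * (t + 2 * t\<^sup>2))"
    using B t by (intro prob_count_le_exp) auto
  also have "\<dots> \<le> exp (- t * \<mu> * real (card B)) / exp (- a * (t + 2 * t\<^sup>2))"
    using A t by (intro divide_right_mono) (auto intro!: mult_right_mono mult_left_mono)
  also have "\<dots> = exp (a * (t + 2 * t\<^sup>2) - t * \<mu> * real (card B))"
    by (simp add: exp_diff[symmetric])
  finally show ?thesis .
qed

section \<open>Procedures that query all pairs of a sample\<close>

primrec query_pairs ::
    "('v \<times> 'v) list \<Rightarrow> 'v rel \<Rightarrow> ('v rel \<Rightarrow> 'v procedure) \<Rightarrow> 'v procedure" where
  "query_pairs [] R k = k R"
| "query_pairs (e # es) R k =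
     Query (fst e) (snd e) (\<lambda>b. query_pairs es (if b then insert e R else R) k)"

text \<open>
  Sampling with replacement may repeat vertices. Counting indices instead of vertices makes the size of
  the acyclic part a sum over independent coordinates.
\<close>

definition dense_acyclic :: "real \<Rightarrow> 'v rel \<Rightarrow> 'v list \<Rightarrow> bool" where
  "dense_acyclic \<theta> E xs \<longleftrightarrow>
     (\<exists>I\<subseteq>{..<length xs}. \<theta> * real (length xs) \<le> real (card I) \<and>
        acyclic (E \<inter> (!) xs ` I \<times> (!) xs ` I))"

definition inspect :: "real \<Rightarrow> 'v list \<Rightarrow> 'v procedure" where
  "inspect \<theta> xs =
     query_pairs (List.product xs xs) {} (\<lambda>R. Decide (dense_acyclic \<theta> R xs))"

primrec sample_each :: "nat \<Rightarrow> 'v list \<Rightarrow> ('v list \<Rightarrow> 'v procedure) \<Rightarrow> 'v procedure" where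
  "sample_each 0 xs k = k xs"
| "sample_each (Suc s) xs k = Sample 1 (\<lambda>vs. sample_each s (vs @ xs) k)"

lemma run_query_pairs:
  "run D (query_pairs es R k) =
     map_pmf (\<lambda>(b, q). (b, q + length es)) (run D (k (R \<union> (set es \<inter> parcs D))))"
proof (induction es arbitrary: R)
  case Nil
  then show ?case by (simp add: pmf.map_ident_strong split_beta)
next
  case (Cons e es)
  have "(if e \<in> parcs D then insert e R else R) \<union> (set es \<inter> parcs D) = R \<union> (set (e # es) \<inter> parcs D)"
    by auto
  then show ?case
    by (simp add: Cons pmf.map_comp comp_def split_beta)
qed

lemma queries_sampled_query_pairs:
  assumes "set es \<subseteq> S \<times> S" "\<And>R. queries_sampled D S (k R)"
  shows "queries_sampled D S (query_pairs es R k)"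
  using assms(1) by (induction es arbitrary: R) (auto simp: assms(2))

lemma requests_le_query_pairs:
  assumes "\<And>R. requests_le D m (k R)"
  shows "requests_le D m (query_pairs es R k)"
  by (induction es arbitrary: R) (auto simp: assms)

lemma run_inspect:
  "run D (inspect \<theta> xs) = return_pmf (dense_acyclic \<theta> (parcs D) xs, (length xs)\<^sup>2)"
proof -
  have "(set xs \<times> set xs \<inter> E) \<inter> (!) xs ` I \<times> (!) xs ` I = E \<inter> (!) xs ` I \<times> (!) xs ` I"
    if "I \<subseteq> {..<length xs}" for I and E :: "'a rel"
    using that by (auto simp: subset_iff)
  then have "dense_acyclic \<theta> (set xs \<times> set xs \<inter> parcs D) xs = dense_acyclic \<theta> (parcs D) xs"
    unfolding dense_acyclic_def by metis
  then show ?thesis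
    by (simp add: inspect_def run_query_pairs power2_eq_square)
qed

lemma queries_sampled_inspect: "set xs \<subseteq> S \<Longrightarrow> queries_sampled D S (inspect \<theta> xs)"
  unfolding inspect_def by (intro queries_sampled_query_pairs) auto

lemma requests_le_inspect: "requests_le D m (inspect \<theta> xs)"
  unfolding inspect_def by (intro requests_le_query_pairs) auto

lemma set_pmf_sample_vertices:
  assumes "finite (pverts D)"
  shows "set_pmf (sample_vertices D s) =
    {vs. set vs \<subseteq> pverts D \<and> distinct vs \<and> length vs = min s (card (pverts D))}" (is "_ = ?L")
proof -
  have "finite {vs. set vs \<subseteq> pverts D \<and> length vs = min s (card (pverts D))}"
    using assms by (rule finite_lists_length_eq)
  then have "finite ?L"
    by (rule finite_subset[rotated]) auto
  moreover obtain vs where "set vs = pverts D" "distinct vs"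
    using finite_distinct_list[OF assms] by blast
  then have "take s vs \<in> ?L"
    using set_take_subset[of s vs] distinct_card[of vs] by (auto simp: min.commute)
  ultimately show ?thesis
    unfolding sample_vertices_def by (intro set_pmf_of_set) auto
qed

lemma sample_vertices_1:
  assumes "finite (pverts D)" "pverts D \<noteq> {}"
  shows "sample_vertices D 1 = map_pmf (\<lambda>v. [v]) (pmf_of_set (pverts D))"
proof -
  have "card (pverts D) \<ge> 1"
    using assms by (simp add: Suc_le_eq card_gt_0_iff)
  then have "{vs. set vs \<subseteq> pverts D \<and> distinct vs \<and> length vs = min 1 (card (pverts D))} =
      (\<lambda>v. [v]) ` pverts D"
    by (auto simp: length_Suc_conv min_def)
  then show ?thesis
    unfolding sample_vertices_def using assms
    by (simp add: map_pmf_of_set_inj inj_on_def)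
qed

lemma run_sample_each:
  assumes "finite (pverts D)" "pverts D \<noteq> {}"
  shows "run D (sample_each s xs k) =
    bind_pmf (Pi_pmf {..<s} dflt (\<lambda>_. pmf_of_set (pverts D))) (\<lambda>x. run D (k (map x [0..<s] @ xs)))"
proof (induction s arbitrary: xs)
  case 0
  then show ?case by (simp add: bind_return_pmf)
next
  case (Suc s)
  have upd: "map (f(s := v)) [0..<s] = map f [0..<s]" for f :: "nat \<Rightarrow> 'a" and v
    by simp
  show ?case
    using assms Suc
    by (simp add: sample_vertices_1[simplified] lessThan_Suc Pi_pmf_insert pair_pmf_def map_pmf_def
        bind_assoc_pmf bind_return_pmf upd)
qed

lemma queries_sampled_sample_each:
  assumes "set xs \<subseteq> S" "\<And>ys T. set ys \<subseteq> T \<Longrightarrow> queries_sampled D T (k ys)"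
  shows "queries_sampled D S (sample_each s xs k)"
  using assms(1)
proof (induction s arbitrary: xs S)
  case (Suc s)
  then show ?case by (auto intro!: Suc.IH)
qed (simp add: assms(2))

lemma requests_le_sample_each:
  assumes "s \<le> m" "\<And>m ys. requests_le D m (k ys)"
  shows "requests_le D m (sample_each s xs k)"
  using assms(1) by (induction s arbitrary: m xs) (auto simp: assms(2))

lemma run_sample_each_queries:
  assumes "finite (pverts D)" "(b, q) \<in> set_pmf (run D (sample_each s xs (inspect \<theta>)))"
  shows "q \<le> (s + length xs)\<^sup>2"
  using assms(2)
proof (induction s arbitrary: xs)
  case 0
  then show ?case by (simp add: run_inspect)
next
  case (Suc s)
  then obtain vs where vs: "vs \<in> set_pmf (sample_vertices D 1)"
    "(b, q) \<in> set_pmf (run D (sample_each s (vs @ xs) (inspect \<theta>)))"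
    by auto
  then have "length vs \<le> 1"
    using set_pmf_sample_vertices[OF assms(1), of 1] by auto
  then have "(s + length (vs @ xs))\<^sup>2 \<le> (Suc s + length xs)\<^sup>2"
    by (intro power_mono) auto
  then show ?case
    using Suc.IH[OF vs(2)] by linarith
qed

text \<open>
  Applied to a list of all vertices, the verdict is the exact answer.
\<close>

lemma dense_acyclic_distinct_iff:
  assumes "distinct xs"
  shows "dense_acyclic \<theta> E xs \<longleftrightarrow>
    (\<exists>S\<subseteq>set xs. \<theta> * real (card (set xs)) \<le> real (card S) \<and> acyclic (E \<inter> S \<times> S))"
proof -
  have inj: "inj_on ((!) xs) {..<length xs}"
    using assms by (auto simp: inj_on_def nth_eq_iff_index_eq)
  have img: "set xs = (!) xs ` {..<length xs}"
    by (auto simp: set_conv_nth)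
  have card: "card ((!) xs ` I) = card I" if "I \<subseteq> {..<length xs}" for I
    using inj that by (meson card_image inj_on_subset)
  show ?thesis
  proof
    assume "dense_acyclic \<theta> E xs"
    then obtain I where "I \<subseteq> {..<length xs}" "\<theta> * real (length xs) \<le> real (card I)"
      "acyclic (E \<inter> (!) xs ` I \<times> (!) xs ` I)"
      unfolding dense_acyclic_def by blast
    then show "\<exists>S\<subseteq>set xs. \<theta> * real (card (set xs)) \<le> real (card S) \<and> acyclic (E \<inter> S \<times> S)"
      using card[of I] distinct_card[OF assms] img by (intro exI[of _ "(!) xs ` I"]) auto
  next
    assume "\<exists>S\<subseteq>set xs. \<theta> * real (card (set xs)) \<le> real (card S) \<and> acyclic (E \<inter> S \<times> S)"
    then obtain S where S: "S \<subseteq> (!) xs ` {..<length xs}" "\<theta> * real (length xs) \<le> real (card S)"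
      "acyclic (E \<inter> S \<times> S)"
      using distinct_card[OF assms] img by auto
    then obtain I where "I \<subseteq> {..<length xs}" "S = (!) xs ` I"
      unfolding subset_image_iff by blast
    then show "dense_acyclic \<theta> E xs"
      unfolding dense_acyclic_def using S card[of I] by (intro exI[of _ I]) simp
  qed
qed

section \<open>The tester and its parameters\<close>

definition admissible :: "real \<Rightarrow> real \<Rightarrow> bool" where
  "admissible \<rho> \<epsilon> \<longleftrightarrow> 0 < \<rho> \<and> \<rho> \<le> 1 \<and> 0 < \<epsilon> \<and> \<epsilon> \<le> \<rho>\<^sup>2 / 8"

text \<open>
  The gap, as a fraction of the sample, between the density \<open>\<rho>\<close> of the property and the acceptance
  threshold \<open>\<rho> - slack\<close>. Final containers have density below \<open>\<rho> - 2 * slack\<close>, so the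
  threshold lies midway.
\<close>

definition slack :: "real \<Rightarrow> real \<Rightarrow> real" where
  "slack \<rho> \<epsilon> = \<epsilon> / (12 * \<rho>)"

text \<open>
  This is \<open>1 / slack\<close> rounded up: digraphs with more vertices satisfy \<open>1 \<le> slack * n\<close>.
\<close>

definition small_order :: "real \<Rightarrow> real \<Rightarrow> nat" where
  "small_order \<rho> \<epsilon> = nat \<lceil>12 * \<rho> / \<epsilon>\<rceil>"

text \<open>
  With \<open>d = \<epsilon> n / (4 \<rho>)\<close> removed at each step, this many steps would exhaust all \<open>n\<close> vertices.
\<close>

definition fingerprint_length :: "real \<Rightarrow> real \<Rightarrow> nat" where
  "fingerprint_length \<rho> \<epsilon> = nat \<lceil>4 * \<rho> / \<epsilon>\<rceil>"

text \<open>
  The union bound over fingerprints asks for a sample of size \<open>s\<close> with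
  \<open>s \<ge> (\<rho> / slack\<^sup>2) * (\<rho> / \<epsilon>) * ln s\<close> up to constants. Its first factors amount to
  a multiple \<open>z\<close> of \<open>\<rho> ^ 4 / \<epsilon> ^ 3\<close>, and \<open>4 * z * ln z\<close> solves \<open>s \<ge> z * ln (s + 1)\<close>. The constant 13000
  exceeds \<open>16 * 12\<^sup>2 * 5\<close>: 16 from the rate of the tail bounds, 12 from the slack, and 5 from
  the number of steps, which is at most \<open>5 * (\<rho> / \<epsilon>)\<close>.
\<close>

definition sample_size :: "real \<Rightarrow> real \<Rightarrow> nat" where
  "sample_size \<rho> \<epsilon> = (let z = 13000 * \<rho> ^ 4 / \<epsilon> ^ 3 in nat \<lceil>4 * z * ln z\<rceil>)"

text \<open>
  The first request serves to recognize digraphs of small order, which are read completely. All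
  others are judged by independent single labels.
\<close>

definition dag_tester :: "real \<Rightarrow> real \<Rightarrow> 'v procedure" where
  "dag_tester \<rho> \<epsilon> = Sample (Suc (small_order \<rho> \<epsilon>))
     (\<lambda>vs. if length vs \<le> small_order \<rho> \<epsilon> then inspect \<rho> vs
           else sample_each (sample_size \<rho> \<epsilon>) [] (inspect (\<rho> - slack \<rho> \<epsilon>)))"

definition query_bound :: "real \<Rightarrow> real \<Rightarrow> real" where
  "query_bound \<rho> \<epsilon> = (real (small_order \<rho> \<epsilon>))\<^sup>2 + (real (sample_size \<rho> \<epsilon>))\<^sup>2"

lemma admissible_quotients:
  assumes "admissible \<rho> \<epsilon>"
  shows "8 \<le> \<rho>\<^sup>2 / \<epsilon>" "8 \<le> \<rho> / \<epsilon>" "1 \<le> 1 / \<epsilon>" "slack \<rho> \<epsilon> \<le> \<rho> / 96" "0 < slack \<rho> \<epsilon>"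
proof -
  have *: "0 < \<rho>" "\<rho> \<le> 1" "0 < \<epsilon>" "\<epsilon> \<le> \<rho>\<^sup>2 / 8"
    using assms by (auto simp: admissible_def)
  show "8 \<le> \<rho>\<^sup>2 / \<epsilon>"
    using * by (simp add: field_simps)
  have "\<rho>\<^sup>2 \<le> \<rho>"
    using * by (simp add: power2_eq_square mult_left_le)
  then show "8 \<le> \<rho> / \<epsilon>"
    using * by (simp add: field_simps)
  show "1 \<le> 1 / \<epsilon>"
    using * \<open>\<rho>\<^sup>2 \<le> \<rho>\<close> by (simp add: field_simps)
  show "slack \<rho> \<epsilon> \<le> \<rho> / 96" "0 < slack \<rho> \<epsilon>"
    using * by (auto simp: slack_def field_simps power2_eq_square)
qed

lemma fingerprint_length_bounds:
  assumes "admissible \<rho> \<epsilon>"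
  shows "4 * \<rho> / \<epsilon> \<le> real (fingerprint_length \<rho> \<epsilon>)" "real (fingerprint_length \<rho> \<epsilon>) \<le> 5 * (\<rho> / \<epsilon>)"
proof -
  have "8 \<le> \<rho> / \<epsilon>"
    using admissible_quotients assms by blast
  moreover have "4 * \<rho> / \<epsilon> \<le> real (fingerprint_length \<rho> \<epsilon>)"
    unfolding fingerprint_length_def by linarith
  moreover have "real (fingerprint_length \<rho> \<epsilon>) \<le> 4 * \<rho> / \<epsilon> + 1"
    unfolding fingerprint_length_def using \<open>8 \<le> \<rho> / \<epsilon>\<close> by linarith
  ultimately show "4 * \<rho> / \<epsilon> \<le> real (fingerprint_length \<rho> \<epsilon>)" "real (fingerprint_length \<rho> \<epsilon>) \<le> 5 * (\<rho> / \<epsilon>)"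
    by auto
qed

lemma sample_size_bounds:
  assumes "admissible \<rho> \<epsilon>" and z: "z = 13000 * \<rho> ^ 4 / \<epsilon> ^ 3"
  shows "1 \<le> ln z" "z * ln (real (sample_size \<rho> \<epsilon>) + 1) \<le> real (sample_size \<rho> \<epsilon>)"
    "z \<le> real (sample_size \<rho> \<epsilon>)" "real (sample_size \<rho> \<epsilon>) \<le> 5 * z * ln z" "13000 \<le> z"
proof -
  let ?s = "real (sample_size \<rho> \<epsilon>)"
  note quot = admissible_quotients[OF assms(1)]
  have "z = 13000 * (\<rho>\<^sup>2 / \<epsilon>)\<^sup>2 * (1 / \<epsilon>)"
    unfolding z by (simp add: field_simps power2_eq_square power3_eq_cube eval_nat_numeral)
  moreover have "1 * 1 \<le> (\<rho>\<^sup>2 / \<epsilon>)\<^sup>2 * (1 / \<epsilon>)"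
    using quot by (intro mult_mono) auto
  ultimately show z1: "13000 \<le> z"
    by simp
  have "exp 1 \<le> z"
    using exp_le z1 by linarith
  then show ln1: "1 \<le> ln z"
    using z1 by (simp add: ln_ge_iff)
  have "?s = real (nat \<lceil>4 * z * ln z\<rceil>)"
    by (simp add: sample_size_def Let_def z)
  moreover have zl: "z \<le> z * ln z"
    using ln1 z1 by simp
  ultimately have s: "4 * (z * ln z) \<le> ?s" "?s \<le> 4 * (z * ln z) + 1"
    using z1 by linarith+
  then show "z \<le> ?s" "?s \<le> 5 * z * ln z"
    using zl z1 by linarith+
  have "z * ln z \<le> z * z"
    using z1 ln_bound[of z] by (intro mult_left_mono) auto
  moreover have "9 * z\<^sup>2 \<le> z\<^sup>2 * z\<^sup>2" "2 \<le> z\<^sup>2"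
  proof -
    have "3 ^ 2 \<le> z ^ 2" using z1 by (intro power_mono) auto
    then have "9 \<le> z\<^sup>2" by simp
    then show "9 * z\<^sup>2 \<le> z\<^sup>2 * z\<^sup>2"
      by (intro mult_right_mono) auto
    show "2 \<le> z\<^sup>2"
      using \<open>9 \<le> z\<^sup>2\<close> by simp
  qed
  ultimately have "?s + 1 \<le> z\<^sup>2 * z\<^sup>2"
    using s(2) by (simp add: power2_eq_square)
  then have "ln (?s + 1) \<le> ln (z ^ 4)"
    by (subst ln_le_cancel_iff) (use z1 in \<open>auto simp: power2_eq_square eval_nat_numeral\<close>)
  also have "\<dots> = 4 * ln z"
    using z1 by (simp add: ln_realpow)
  finally have "z * ln (?s + 1) \<le> z * (4 * ln z)"
    using z1 by (intro mult_left_mono) auto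
  then show "z * ln (?s + 1) \<le> ?s"
    using s(1) by simp
qed

text \<open>
  The number of fingerprints, each a list of sample indices and \<open>None\<close> entries, times the failure
  probability of a single one.
\<close>

lemma union_bound_numeric:
  assumes "admissible \<rho> \<epsilon>"
  shows "real (sample_size \<rho> \<epsilon> + 1) ^ fingerprint_length \<rho> \<epsilon> *
           exp (- real (sample_size \<rho> \<epsilon>) * (slack \<rho> \<epsilon>)\<^sup>2 / (16 * \<rho>)) \<le> 1 / 3"
proof -
  let ?s = "real (sample_size \<rho> \<epsilon>)" and ?q = "fingerprint_length \<rho> \<epsilon>"
  define z where "z = 13000 * \<rho> ^ 4 / \<epsilon> ^ 3"
  have pos: "0 < \<rho>" "0 < \<epsilon>"
    using assms by (auto simp: admissible_def)
  note quot = admissible_quotients[OF assms]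
  note size = sample_size_bounds[OF assms z_def]
  let ?l = "ln (?s + 1)"
  have "exp 1 \<le> ?s + 1"
    using exp_le size(3,5) by linarith
  then have l1: "1 \<le> ?l"
    by (subst ln_ge_iff) auto
  have "5 * (\<rho> / \<epsilon>) * ?l + 2 \<le> 5.6 * (\<rho> / \<epsilon>) * ?l"
  proof -
    have "8 * 1 \<le> \<rho> / \<epsilon> * ?l"
      using quot(2) l1 by (intro mult_mono) auto
    then show ?thesis by simp
  qed
  also have "\<dots> \<le> 13000 / 2304 * (\<rho> / \<epsilon>) * ?l"
    using quot(2) l1 by (intro mult_right_mono) auto
  also have "\<dots> = z * ?l * (slack \<rho> \<epsilon>)\<^sup>2 / (16 * \<rho>)"
    using pos unfolding z_def slack_def
    by (simp add: field_simps power2_eq_square power3_eq_cube eval_nat_numeral)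
  also have "\<dots> \<le> ?s * (slack \<rho> \<epsilon>)\<^sup>2 / (16 * \<rho>)"
    using size(2) pos by (intro divide_right_mono mult_right_mono) auto
  finally have main: "5 * (\<rho> / \<epsilon>) * ?l + 2 \<le> ?s * (slack \<rho> \<epsilon>)\<^sup>2 / (16 * \<rho>)" .
  have "real ?q * ?l \<le> 5 * (\<rho> / \<epsilon>) * ?l"
    using fingerprint_length_bounds[OF assms] l1 by (intro mult_right_mono) auto
  with main have le: "real ?q * ?l - ?s * (slack \<rho> \<epsilon>)\<^sup>2 / (16 * \<rho>) \<le> - 2"
    by linarith
  have "real (sample_size \<rho> \<epsilon> + 1) ^ ?q = exp (real ?q * ?l)"
    by (simp add: exp_of_nat_mult add.commute)
  then have "real (sample_size \<rho> \<epsilon> + 1) ^ ?q * exp (- ?s * (slack \<rho> \<epsilon>)\<^sup>2 / (16 * \<rho>)) =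
      exp (real ?q * ?l - ?s * (slack \<rho> \<epsilon>)\<^sup>2 / (16 * \<rho>))"
    by (simp add: exp_add[symmetric])
  also have "\<dots> \<le> exp (- 2)"
    using le by simp
  also have "\<dots> \<le> 1 / 3"
    using exp_ge_add_one_self[of 2] by (simp add: exp_minus field_simps)
  finally show ?thesis .
qed

lemma tail_numeric:
  assumes "admissible \<rho> \<epsilon>"
  shows "exp (- real (sample_size \<rho> \<epsilon>) * (slack \<rho> \<epsilon>)\<^sup>2 / (16 * \<rho>)) \<le> 1 / 3"
proof -
  let ?e = "exp (- real (sample_size \<rho> \<epsilon>) * (slack \<rho> \<epsilon>)\<^sup>2 / (16 * \<rho>))"
  have "1 * ?e \<le> real (sample_size \<rho> \<epsilon> + 1) ^ fingerprint_length \<rho> \<epsilon> * ?e"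
    by (intro mult_right_mono one_le_power) auto
  then show ?thesis
    using union_bound_numeric[OF assms] by linarith
qed

lemma fingerprint_length_le_slack:
  assumes "admissible \<rho> \<epsilon>"
  shows "real (fingerprint_length \<rho> \<epsilon>) \<le> slack \<rho> \<epsilon> * real (sample_size \<rho> \<epsilon>) / 2"
proof -
  define z where "z = 13000 * \<rho> ^ 4 / \<epsilon> ^ 3"
  have pos: "0 < \<rho>" "0 < \<epsilon>"
    using assms by (auto simp: admissible_def)
  note quot = admissible_quotients[OF assms]
  have "5 * (\<rho> / \<epsilon>) \<le> 500 * (\<rho>\<^sup>2 / \<epsilon>) * (\<rho> / \<epsilon>)"
    using quot by (intro mult_right_mono) auto
  also have "\<dots> \<le> 13000 / 24 * (\<rho>\<^sup>2 / \<epsilon>) * (\<rho> / \<epsilon>)"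
    using quot by (intro mult_right_mono) auto
  also have "\<dots> = slack \<rho> \<epsilon> * z / 2"
    using pos unfolding z_def slack_def
    by (simp add: field_simps power2_eq_square power3_eq_cube eval_nat_numeral)
  also have "\<dots> \<le> slack \<rho> \<epsilon> * real (sample_size \<rho> \<epsilon>) / 2"
    using sample_size_bounds(3)[OF assms z_def] quot(5) by (simp add: mult_left_mono)
  finally show ?thesis
    using fingerprint_length_bounds(2)[OF assms] by linarith
qed

section \<open>Completeness and soundness\<close>

lemma nth_map_upt_image: "I \<subseteq> {..<s} \<Longrightarrow> (!) (map x [0..<s]) ` I = x ` I"
  by (force simp: subset_iff)

lemma large_order:
  assumes "admissible \<rho> \<epsilon>" "small_order \<rho> \<epsilon> < n"
  shows "1 \<le> slack \<rho> \<epsilon> * real n"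
proof -
  have "12 * \<rho> / \<epsilon> \<le> real (small_order \<rho> \<epsilon>)"
    unfolding small_order_def by linarith
  then have "12 * \<rho> / \<epsilon> \<le> real n"
    using assms(2) by linarith
  then show ?thesis
    using assms(1) by (simp add: slack_def admissible_def field_simps)
qed

text \<open>
  The sample points that fall into a fixed acyclic set of density \<open>\<rho>\<close> form an acyclic part of the sample,
  and their number concentrates.
\<close>

lemma prob_sample_dense_acyclic_complete:
  fixes D :: "'v pair_pre_digraph"
  assumes D: "pair_fin_digraph D" and adm: "admissible \<rho> \<epsilon>"
    and dag: "rho_dag \<rho> D" and ne: "pverts D \<noteq> {}"
  defines "M \<equiv> Pi_pmf {..<sample_size \<rho> \<epsilon>} undefined (\<lambda>_. pmf_of_set (pverts D))"
  shows "measure_pmf.prob M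
    {x. \<not> dense_acyclic (\<rho> - slack \<rho> \<epsilon>) (parcs D) (map x [0..<sample_size \<rho> \<epsilon>])} \<le> 1 / 3"
proof -
  let ?s = "sample_size \<rho> \<epsilon>" and ?\<delta> = "slack \<rho> \<epsilon>" and ?V = "pverts D"
  let ?t = "?\<delta> / (4 * \<rho>)"
  have pos: "0 < \<rho>"
    using adm by (auto simp: admissible_def)
  note quot = admissible_quotients[OF adm]
  have fin: "finite ?V"
    using D by (simp add: pair_fin_digraph.pair_finite_verts)
  obtain S where S: "S \<subseteq> ?V" "\<rho> * real (card ?V) \<le> real (card S)" "acyclic (parcs D \<inter> S \<times> S)"
    using dag unfolding rho_dag_iff by blast
  have "dense_acyclic (\<rho> - ?\<delta>) (parcs D) (map x [0..<?s])"
    if "(\<rho> - ?\<delta>) * real ?s \<le> real (card {i \<in> {..<?s}. x i \<in> S})" for x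
    unfolding dense_acyclic_def
  proof (intro exI[of _ "{i \<in> {..<?s}. x i \<in> S}"] conjI)
    let ?I = "{i \<in> {..<?s}. x i \<in> S}"
    have "(!) (map x [0..<?s]) ` ?I = x ` ?I"
      by (rule nth_map_upt_image) auto
    then show "acyclic (parcs D \<inter> (!) (map x [0..<?s]) ` ?I \<times> (!) (map x [0..<?s]) ` ?I)"
      by (intro acyclic_subset[OF S(3)]) auto
  qed (use that in auto)
  then have "measure_pmf.prob M {x. \<not> dense_acyclic (\<rho> - ?\<delta>) (parcs D) (map x [0..<?s])} \<le>
      measure_pmf.prob M {x. real (card {i \<in> {..<?s}. x i \<in> S}) \<le> (\<rho> - ?\<delta>) * real ?s}"
    by (intro measure_pmf.finite_measure_mono) (auto simp: not_le intro: less_imp_le, meson linorder_le_cases)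
  also have "\<dots> \<le> exp ((\<rho> - ?\<delta>) * real ?s * (?t + 2 * ?t\<^sup>2) - ?t * \<rho> * real (card {..<?s}))"
    unfolding M_def
  proof (intro prob_count_lower_tail)
    have "measure_pmf.prob (pmf_of_set ?V) S = real (card S) / real (card ?V)"
      using S(1) fin ne by (simp add: measure_pmf_of_set Int_absorb1)
    moreover have "0 < real (card ?V)"
      using fin ne by (simp add: card_gt_0_iff)
    ultimately show "\<rho> \<le> measure_pmf.prob (pmf_of_set ?V) S"
      using S(2) by (simp add: pos_le_divide_eq)
    show "0 \<le> ?t" "?t \<le> 1 / 2"
      using quot pos by (auto simp: field_simps)
  qed simp
  also have "\<dots> \<le> exp (- real ?s * ?\<delta>\<^sup>2 / (16 * \<rho>))"
  proof -
    have eq: "(\<rho> - ?\<delta>) * (t + 2 * t\<^sup>2) - t * \<rho> = 2 * \<rho> * t\<^sup>2 - ?\<delta> * t - 2 * (?\<delta> * t\<^sup>2)" for t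
      by (simp add: algebra_simps)
    have "0 \<le> ?\<delta> * ?t\<^sup>2"
      using quot(5) by simp
    then have "(\<rho> - ?\<delta>) * (?t + 2 * ?t\<^sup>2) - ?t * \<rho> \<le> 2 * \<rho> * ?t\<^sup>2 - ?\<delta> * ?t"
      using eq[of ?t] by linarith
    also have "\<dots> = - (?\<delta>\<^sup>2 / (8 * \<rho>))"
      using pos by (simp add: field_simps power2_eq_square)
    also have "\<dots> \<le> - (?\<delta>\<^sup>2 / (16 * \<rho>))"
      using pos by (simp add: field_simps)
    finally have le: "real ?s * ((\<rho> - ?\<delta>) * (?t + 2 * ?t\<^sup>2) - ?t * \<rho>) \<le> real ?s * - (?\<delta>\<^sup>2 / (16 * \<rho>))"
      by (intro mult_left_mono) auto
    have "(\<rho> - ?\<delta>) * real ?s * (t + 2 * t\<^sup>2) - t * \<rho> * real ?s =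
        real ?s * ((\<rho> - ?\<delta>) * (t + 2 * t\<^sup>2) - t * \<rho>)" for t
      by (simp add: algebra_simps)
    then have "(\<rho> - ?\<delta>) * real ?s * (?t + 2 * ?t\<^sup>2) - ?t * \<rho> * real ?s \<le> - real ?s * ?\<delta>\<^sup>2 / (16 * \<rho>)"
      using le by (simp only: times_divide_eq_right minus_mult_right minus_mult_left minus_divide_left)
    then show ?thesis
      by (simp only: exp_le_cancel_iff card_lessThan)
  qed
  finally show ?thesis
    using tail_numeric[OF adm] by linarith
qed

text \<open>
  A dense acyclic part of the sample lies in the container given by a fingerprint consisting of a
  few of its own points. For each of the \<open>(s + 1) ^ q\<close> choices of fingerprint indices, condition on
  these points: the container is then fixed, of density below \<open>\<rho> - 2 * slack\<close>, and the remaining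
  independent points would have to fall into it at least \<open>(\<rho> - 3 / 2 * slack) * s\<close> times. The union
  bound runs over indices, not over vertices, so it does not depend on \<open>n\<close>.
\<close>

lemma prob_sample_dense_acyclic_sound:
  fixes D :: "'v pair_pre_digraph"
  assumes D: "pair_fin_digraph D" and adm: "admissible \<rho> \<epsilon>"
    and far: "eps_far (rho_dag \<rho>) \<epsilon> D" and large: "small_order \<rho> \<epsilon> < card (pverts D)"
  defines "M \<equiv> Pi_pmf {..<sample_size \<rho> \<epsilon>} undefined (\<lambda>_. pmf_of_set (pverts D))"
  shows "measure_pmf.prob M
    {x. dense_acyclic (\<rho> - slack \<rho> \<epsilon>) (parcs D) (map x [0..<sample_size \<rho> \<epsilon>])} \<le> 1 / 3"
proof -
  let ?s = "sample_size \<rho> \<epsilon>" and ?q = "fingerprint_length \<rho> \<epsilon>" and ?\<delta> = "slack \<rho> \<epsilon>"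
  let ?V = "pverts D" and ?E = "parcs D"
  define n where "n = real (card ?V)"
  define d where "d = \<epsilon> * n / (4 * \<rho>)"
  let ?t = "?\<delta> / (4 * \<rho>)"
  define a where "a = (\<rho> - ?\<delta>) * real ?s - real ?q"
  have pos: "0 < \<rho>" "\<rho> \<le> 1" "0 < \<epsilon>" "\<epsilon> \<le> \<rho>\<^sup>2"
    using adm by (auto simp: admissible_def)
  note quot = admissible_quotients[OF adm]
  have fin: "finite ?V"
    using D by (simp add: pair_fin_digraph.pair_finite_verts)
  have ne: "?V \<noteq> {}"
    using large by auto
  have n0: "0 < n"
    using fin ne by (simp add: n_def card_gt_0_iff)
  define K where "K \<sigma> x = container ?E d ?V (map (map_option x) \<sigma>)" for \<sigma> and x :: "nat \<Rightarrow> 'v"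
  define J where "J \<sigma> = {i. Some i \<in> set \<sigma>}" for \<sigma> :: "nat option list"
  define \<Sigma> where "\<Sigma> = {\<sigma>. set \<sigma> \<subseteq> insert None (Some ` {..<?s}) \<and> length \<sigma> = ?q}"
  define Ev where "Ev \<sigma> = {x. out_core ?E d (K \<sigma> x) = {} \<and>
      a \<le> real (card {i \<in> {..<?s} - J \<sigma>. x i \<in> K \<sigma> x})}" for \<sigma>
  \<comment> \<open>\<open>K \<sigma> x\<close> is the container, \<open>J \<sigma>\<close> the coordinates that determine it. The threshold \<open>a\<close> allows
    for all of \<open>J \<sigma>\<close> being hits.\<close>
  have fin\<Sigma>: "finite \<Sigma>" and card\<Sigma>: "card \<Sigma> = (?s + 1) ^ ?q"
  proof -
    have "card (insert None (Some ` {..<?s})) = ?s + 1"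
      by (subst card_insert_disjoint) (auto simp: card_image)
    then show "finite \<Sigma>" "card \<Sigma> = (?s + 1) ^ ?q"
      unfolding \<Sigma>_def by (simp_all add: finite_lists_length_eq card_lists_length_eq)
  qed
  have covered: "\<exists>\<sigma>\<in>\<Sigma>. x \<in> Ev \<sigma>"
    if x: "x \<in> set_pmf M" and dense: "dense_acyclic (\<rho> - ?\<delta>) ?E (map x [0..<?s])" for x
  proof -
    have xV: "x i \<in> ?V" if "i < ?s" for i
      using x that fin ne unfolding M_def by (auto simp: set_Pi_pmf PiE_dflt_def)
    obtain I where I: "I \<subseteq> {..<?s}" "(\<rho> - ?\<delta>) * real ?s \<le> real (card I)" "acyclic (?E \<inter> x ` I \<times> x ` I)"
      using dense unfolding dense_acyclic_def by (auto simp: nth_map_upt_image)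
    have "x ` I \<subseteq> ?V"
      using xV I(1) by auto
    then obtain \<tau> where \<tau>: "length \<tau> = ?q" "set \<tau> \<subseteq> insert None (Some ` x ` I)"
      "x ` I \<subseteq> container ?E d ?V \<tau>"
      "out_core ?E d (container ?E d ?V \<tau>) = {} \<or>
       real ?q * d \<le> real (card ?V) - real (card (container ?E d ?V \<tau>))"
      using fingerprint_exists[OF fin _ I(3), of ?q d] by blast
    have "\<tau> \<in> lists (map_option x ` insert None (Some ` I))"
      using \<tau>(2) by (auto simp: image_image)
    then obtain \<sigma> where \<sigma>: "\<sigma> \<in> lists (insert None (Some ` I))" "\<tau> = map (map_option x) \<sigma>"
      unfolding lists_image by blast
    have K: "container ?E d ?V \<tau> = K \<sigma> x"
      by (simp add: K_def \<sigma>(2))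
    have "out_core ?E d (K \<sigma> x) = {}"
    proof (rule ccontr)
      \<comment> \<open>All \<open>q\<close> steps would have removed \<open>d\<close> vertices, leaving none.\<close>
      assume *: "out_core ?E d (K \<sigma> x) \<noteq> {}"
      have "n = 4 * \<rho> / \<epsilon> * d"
        unfolding d_def using pos by simp
      also have "\<dots> \<le> real ?q * d"
        using fingerprint_length_bounds(1)[OF adm] pos n0 by (intro mult_right_mono) (auto simp: d_def)
      finally have "card (K \<sigma> x) = 0"
        using * \<tau>(4) unfolding K n_def by auto
      moreover have "finite (K \<sigma> x)"
        unfolding K_def by (rule finite_subset[OF container_subset fin])
      ultimately show False
        using * out_core_subset[of ?E d "K \<sigma> x"] by auto
    qed
    moreover have "a \<le> real (card {i \<in> {..<?s} - J \<sigma>. x i \<in> K \<sigma> x})"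
    proof -
      have "J \<sigma> = the ` (set \<sigma> - {None})"
        unfolding J_def by force
      then have J: "finite (J \<sigma>)" "card (J \<sigma>) \<le> ?q"
        using \<tau>(1) \<sigma>(2) card_image_le[of "set \<sigma> - {None}" the] card_length[of \<sigma>]
          card_mono[of "set \<sigma>" "set \<sigma> - {None}"]
        by (auto simp: J_def)
      have "I - J \<sigma> \<subseteq> {i \<in> {..<?s} - J \<sigma>. x i \<in> K \<sigma> x}"
        using I(1) \<tau>(3) unfolding K by auto
      then have "card (I - J \<sigma>) \<le> card {i \<in> {..<?s} - J \<sigma>. x i \<in> K \<sigma> x}"
        by (intro card_mono) auto
      moreover have "card I - card (J \<sigma>) \<le> card (I - J \<sigma>)"
        using J(1) by (rule diff_card_le_card_Diff)
      ultimately show ?thesis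
        unfolding a_def using I(2) J(2) by linarith
    qed
    moreover have "\<sigma> \<in> \<Sigma>"
      using \<sigma> \<tau>(1) I(1) unfolding \<Sigma>_def by auto
    ultimately show ?thesis
      unfolding Ev_def by auto
  qed
  have prob_Ev: "measure_pmf.prob M (Ev \<sigma>) \<le> exp (- real ?s * ?\<delta>\<^sup>2 / (16 * \<rho>))" if \<sigma>: "\<sigma> \<in> \<Sigma>" for \<sigma>
    unfolding M_def
  proof (rule prob_Pi_pmf_le_conditional)
    show "J \<sigma> \<subseteq> {..<?s}"
      using \<sigma> unfolding J_def \<Sigma>_def by auto
    fix f :: "nat \<Rightarrow> 'v"
    let ?B = "{..<?s} - J \<sigma>"
    let ?P = "Pi_pmf ?B undefined (\<lambda>_. pmf_of_set ?V)"
    have same: "K \<sigma> (\<lambda>i. if i \<in> J \<sigma> then f i else g i) = K \<sigma> f" for g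
    proof -
      have "map (map_option (\<lambda>i. if i \<in> J \<sigma> then f i else g i)) \<sigma> = map (map_option f) \<sigma>"
        by (auto simp: J_def intro!: option.map_cong)
      then show ?thesis
        unfolding K_def by (rule arg_cong)
    qed
    have count: "{i \<in> ?B. (if i \<in> J \<sigma> then f i else g i) \<in> K \<sigma> f} = {i \<in> ?B. g i \<in> K \<sigma> f}" for g
      by auto
    show "measure_pmf.prob ?P {g. (\<lambda>i. if i \<in> J \<sigma> then f i else g i) \<in> Ev \<sigma>} \<le>
        exp (- real ?s * ?\<delta>\<^sup>2 / (16 * \<rho>))"
    proof (cases "out_core ?E d (K \<sigma> f) = {}")
      case False
      then show ?thesis
        unfolding Ev_def mem_Collect_eq same by simp
    next
      case True
      have KV: "K \<sigma> f \<subseteq> ?V"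
        unfolding K_def by (rule container_subset)
      have "real (card (K \<sigma> f)) < (\<rho> - 2 * ?\<delta>) * n"
        by (rule far_imp_core_free_small[OF D far pos slack_def n_def _ KV])
           (use True large_order[OF adm large] in \<open>simp_all add: n_def d_def\<close>)
      moreover have "measure_pmf.prob (pmf_of_set ?V) (K \<sigma> f) = real (card (K \<sigma> f)) / n"
        using fin ne KV by (simp add: measure_pmf_of_set Int_absorb1 n_def)
      ultimately have \<mu>: "measure_pmf.prob (pmf_of_set ?V) (K \<sigma> f) \<le> \<rho> - 2 * ?\<delta>"
        using n0 by (simp add: pos_divide_le_eq)
      have a: "(\<rho> - 3 / 2 * ?\<delta>) * real ?s \<le> a"
        using fingerprint_length_le_slack[OF adm] unfolding a_def by (simp add: algebra_simps)
      have t: "0 \<le> ?t" "?t \<le> 1"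
        using quot pos by (auto simp: field_simps)
      have tt: "0 \<le> ?t - ?t\<^sup>2"
        using mult_left_le[OF t(2,1)] by (simp only: power2_eq_square diff_ge_0_iff_ge)
      have "measure_pmf.prob ?P {g. (\<lambda>i. if i \<in> J \<sigma> then f i else g i) \<in> Ev \<sigma>} =
          measure_pmf.prob ?P {g. a \<le> real (card {i \<in> ?B. g i \<in> K \<sigma> f})}"
        unfolding Ev_def mem_Collect_eq same count using True by simp
      also have "\<dots> \<le> exp (?t * (\<rho> - 2 * ?\<delta>) * real ?s - a * (?t - ?t\<^sup>2))"
      proof (rule prob_count_upper_tail[OF _ _ \<mu> t])
        show "real (card ?B) \<le> real ?s"
          using card_mono[of "{..<?s}" ?B] by auto
        have "0 \<le> (\<rho> - 3 / 2 * ?\<delta>) * real ?s"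
          using quot pos by (intro mult_nonneg_nonneg) auto
        then show "0 \<le> a"
          using a by linarith
      qed simp
      also have "\<dots> \<le> exp (- real ?s * ?\<delta>\<^sup>2 / (16 * \<rho>))"
      proof -
        have eq: "t * (\<rho> - 2 * ?\<delta>) - (\<rho> - 3 / 2 * ?\<delta>) * (t - t\<^sup>2) =
            \<rho> * t\<^sup>2 - ?\<delta> * t / 2 - 3 / 2 * (?\<delta> * t\<^sup>2)" for t
          by (simp add: field_simps)
        have "0 \<le> ?\<delta> * ?t\<^sup>2"
          using quot(5) by simp
        then have "?t * (\<rho> - 2 * ?\<delta>) - (\<rho> - 3 / 2 * ?\<delta>) * (?t - ?t\<^sup>2) \<le> \<rho> * ?t\<^sup>2 - ?\<delta> * ?t / 2"
          using eq[of ?t] by linarith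
        also have "\<dots> = - (?\<delta>\<^sup>2 / (16 * \<rho>))"
          using pos by (simp add: field_simps power2_eq_square)
        finally have le: "real ?s * (?t * (\<rho> - 2 * ?\<delta>) - (\<rho> - 3 / 2 * ?\<delta>) * (?t - ?t\<^sup>2)) \<le>
            real ?s * - (?\<delta>\<^sup>2 / (16 * \<rho>))"
          by (intro mult_left_mono) auto
        have eq': "t * (\<rho> - 2 * ?\<delta>) * real ?s - (\<rho> - 3 / 2 * ?\<delta>) * real ?s * (t - t\<^sup>2) =
            real ?s * (t * (\<rho> - 2 * ?\<delta>) - (\<rho> - 3 / 2 * ?\<delta>) * (t - t\<^sup>2))" for t
          by (simp add: algebra_simps)
        have "?t * (\<rho> - 2 * ?\<delta>) * real ?s - a * (?t - ?t\<^sup>2) \<le>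
            ?t * (\<rho> - 2 * ?\<delta>) * real ?s - (\<rho> - 3 / 2 * ?\<delta>) * real ?s * (?t - ?t\<^sup>2)"
          by (rule diff_left_mono[OF mult_right_mono[OF a tt]])
        also have "\<dots> \<le> - real ?s * ?\<delta>\<^sup>2 / (16 * \<rho>)"
          unfolding eq' using le
          by (simp only: times_divide_eq_right minus_mult_right minus_mult_left minus_divide_left)
        finally show ?thesis
          by (simp only: exp_le_cancel_iff)
      qed
      finally show ?thesis .
    qed
  qed simp
  have "measure_pmf.prob M {x. dense_acyclic (\<rho> - ?\<delta>) ?E (map x [0..<?s])} \<le>
      measure_pmf.prob M (\<Union>\<sigma>\<in>\<Sigma>. Ev \<sigma>)"
    by (intro measure_pmf.finite_measure_mono_AE) (auto simp: AE_measure_pmf_iff covered)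
  also have "\<dots> \<le> (\<Sum>\<sigma>\<in>\<Sigma>. measure_pmf.prob M (Ev \<sigma>))"
    using fin\<Sigma> by (intro measure_pmf.finite_measure_subadditive_finite) auto
  also have "\<dots> \<le> real (card \<Sigma>) * exp (- real ?s * ?\<delta>\<^sup>2 / (16 * \<rho>))"
    by (rule sum_bounded_above[OF prob_Ev])
  also have "\<dots> \<le> 1 / 3"
    using union_bound_numeric[OF adm] by (simp add: card\<Sigma>)
  finally show ?thesis .
qed

lemma prob_map_pmf_eq: "measure_pmf.prob (map_pmf f p) E = measure_pmf.prob p {x. f x \<in> E}"
  by (simp add: vimage_def)

lemma two_sided_tester_dag_tester:
  assumes adm: "admissible \<rho> \<epsilon>"
  shows "two_sided_tester (rho_dag \<rho> :: 'v pair_pre_digraph \<Rightarrow> bool) \<epsilon> (dag_tester \<rho> \<epsilon>)"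
  unfolding two_sided_tester_def
proof (intro allI impI conjI)
  fix D :: "'v pair_pre_digraph"
  assume D: "pair_fin_digraph D"
  let ?V = "pverts D" and ?s = "sample_size \<rho> \<epsilon>" and ?\<theta> = "\<rho> - slack \<rho> \<epsilon>"
  let ?M = "Pi_pmf {..<?s} undefined (\<lambda>_. pmf_of_set ?V)"
  let ?A = "\<lambda>vs. if length vs \<le> small_order \<rho> \<epsilon> then inspect \<rho> vs
           else sample_each ?s [] (inspect ?\<theta>)"
  have fin: "finite ?V"
    using D by (simp add: pair_fin_digraph.pair_finite_verts)
  show "queries_sampled D {} (dag_tester \<rho> \<epsilon>)"
    unfolding dag_tester_def
    by (auto intro: queries_sampled_inspect queries_sampled_sample_each)
  have sampled: "set vs \<subseteq> ?V" "distinct vs" "length vs = min (Suc (small_order \<rho> \<epsilon>)) (card ?V)"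
    if "vs \<in> set_pmf (sample_vertices D (Suc (small_order \<rho> \<epsilon>)))" for vs
    using that set_pmf_sample_vertices[OF fin] by auto
  have small: "run D (?A vs) = return_pmf (rho_dag \<rho> D, (length vs)\<^sup>2)"
    if vs: "vs \<in> set_pmf (sample_vertices D (Suc (small_order \<rho> \<epsilon>)))"
      and le: "length vs \<le> small_order \<rho> \<epsilon>" for vs
  proof -
    have "set vs = ?V"
      using sampled[OF vs] le fin by (intro card_subset_eq) (auto simp: distinct_card)
    then show ?thesis
      using le dense_acyclic_distinct_iff[OF sampled(2)[OF vs], of \<rho> "parcs D"]
      by (simp add: run_inspect rho_dag_iff)
  qed
  have large: "run D (?A vs) = map_pmf (\<lambda>x. (dense_acyclic ?\<theta> (parcs D) (map x [0..<?s]), ?s\<^sup>2)) ?M"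
    "small_order \<rho> \<epsilon> < card ?V"
    if vs: "vs \<in> set_pmf (sample_vertices D (Suc (small_order \<rho> \<epsilon>)))"
      and le: "\<not> length vs \<le> small_order \<rho> \<epsilon>" for vs
  proof -
    show "small_order \<rho> \<epsilon> < card ?V"
      using sampled(3)[OF vs] le by simp
    then have "?V \<noteq> {}"
      by auto
    then show "run D (?A vs) = map_pmf (\<lambda>x. (dense_acyclic ?\<theta> (parcs D) (map x [0..<?s]), ?s\<^sup>2)) ?M"
      using le fin by (simp add: run_sample_each[where dflt = undefined] run_inspect map_pmf_def)
  qed
  show "2 / 3 \<le> measure_pmf.prob (run D (dag_tester \<rho> \<epsilon>)) {(b, q). b}" if dag: "rho_dag \<rho> D"
    unfolding dag_tester_def run.simps
  proof (rule prob_bind_pmf_ge)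
    fix vs assume vs: "vs \<in> set_pmf (sample_vertices D (Suc (small_order \<rho> \<epsilon>)))"
    show "2 / 3 \<le> measure_pmf.prob (run D (?A vs)) {(b, q). b}"
    proof (cases "length vs \<le> small_order \<rho> \<epsilon>")
      case True
      show ?thesis
        unfolding small[OF vs True] using dag by simp
    next
      case False
      then have "?V \<noteq> {}"
        using large(2)[OF vs] by auto
      then have "measure_pmf.prob ?M {x. \<not> dense_acyclic ?\<theta> (parcs D) (map x [0..<?s])} \<le> 1 / 3"
        by (rule prob_sample_dense_acyclic_complete[OF D adm dag])
      then show ?thesis
        unfolding large(1)[OF vs False] prob_map_pmf_eq
        using measure_pmf.prob_neg[of ?M "\<lambda>x. dense_acyclic ?\<theta> (parcs D) (map x [0..<?s])"]
        by simp
    qed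
  qed
  show "2 / 3 \<le> measure_pmf.prob (run D (dag_tester \<rho> \<epsilon>)) {(b, q). \<not> b}"
    if far: "eps_far (rho_dag \<rho>) \<epsilon> D"
    unfolding dag_tester_def run.simps
  proof (rule prob_bind_pmf_ge)
    fix vs assume vs: "vs \<in> set_pmf (sample_vertices D (Suc (small_order \<rho> \<epsilon>)))"
    show "2 / 3 \<le> measure_pmf.prob (run D (?A vs)) {(b, q). \<not> b}"
    proof (cases "length vs \<le> small_order \<rho> \<epsilon>")
      case True
      have "digraph_dist D D = 0"
        by (simp add: digraph_dist_def)
      then have "\<not> rho_dag \<rho> D"
        using far D adm unfolding eps_far_def admissible_def by force
      then show ?thesis
        unfolding small[OF vs True] by simp
    next
      case False
      have "measure_pmf.prob ?M {x. dense_acyclic ?\<theta> (parcs D) (map x [0..<?s])} \<le> 1 / 3"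
        using prob_sample_dense_acyclic_sound[OF D adm far] large(2)[OF vs False] by blast
      then show ?thesis
        unfolding large(1)[OF vs False] prob_map_pmf_eq
        using measure_pmf.prob_neg[of ?M "\<lambda>x. dense_acyclic ?\<theta> (parcs D) (map x [0..<?s])"]
        by simp
    qed
  qed
qed

lemma size_oblivious_dag_tester: "size_oblivious (dag_tester \<rho> \<epsilon>)"
  unfolding size_oblivious_def dag_tester_def
  by (intro exI[of _ "Suc (small_order \<rho> \<epsilon>) + sample_size \<rho> \<epsilon>"])
     (auto intro: requests_le_inspect requests_le_sample_each)

lemma query_complexity_dag_tester: "query_complexity_le (dag_tester \<rho> \<epsilon>) (query_bound \<rho> \<epsilon>)"
  unfolding query_complexity_le_def
proof (intro allI impI ballI, clarify)
  fix D :: "'v pair_pre_digraph" and b q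
  assume D: "pair_fin_digraph D" and bq: "(b, q) \<in> set_pmf (run D (dag_tester \<rho> \<epsilon>))"
  have fin: "finite (pverts D)"
    using D by (simp add: pair_fin_digraph.pair_finite_verts)
  let ?m = "small_order \<rho> \<epsilon>" and ?s = "sample_size \<rho> \<epsilon>"
  obtain vs where "(b, q) \<in> set_pmf (run D (if length vs \<le> ?m then inspect \<rho> vs
           else sample_each ?s [] (inspect (\<rho> - slack \<rho> \<epsilon>))))"
    using bq unfolding dag_tester_def by auto
  then have "q \<le> ?m\<^sup>2 \<or> q \<le> ?s\<^sup>2"
    using run_sample_each_queries[OF fin, of b q ?s "[]"]
    by (auto simp: run_inspect power_mono split: if_splits)
  then have "q \<le> ?m\<^sup>2 + ?s\<^sup>2"
    by linarith
  then have "real q \<le> real (?m\<^sup>2 + ?s\<^sup>2)"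
    by (simp only: of_nat_le_iff)
  then show "real q \<le> query_bound \<rho> \<epsilon>"
    by (simp add: query_bound_def)
qed

section \<open>Query complexity\<close>

abbreviation log_factor :: "real \<Rightarrow> real \<Rightarrow> real" where
  "log_factor \<rho> \<epsilon> \<equiv> ln (2 + 1 / \<epsilon>) + ln (2 + 1 / \<rho>)"

lemma log_factor_ge_1:
  assumes "0 < \<rho>" "\<rho> \<le> 1" "0 < \<epsilon>"
  shows "1 \<le> log_factor \<rho> \<epsilon>"
proof -
  have "1 \<le> ln (2 + 1 / \<rho>)"
    using assms exp_le by (subst ln_ge_iff) (auto simp: field_simps intro: add_pos_pos order_trans[OF mult_left_mono[OF exp_le]])
  moreover have "0 \<le> ln (2 + 1 / \<epsilon>)"
    using assms by simp
  ultimately show ?thesis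
    by linarith
qed

text \<open>
  With \<open>G = \<rho> ^ 6 / \<epsilon> ^ 4\<close>, the claim is that the sample size is at most \<open>G\<close> up to a logarithm. It
  is of order \<open>\<rho> ^ 4 / \<epsilon> ^ 3 = G / (\<rho>\<^sup>2 / \<epsilon>)\<close> up to a logarithm, and \<open>\<rho>\<^sup>2 / \<epsilon> \<ge> 8\<close>.
\<close>

lemma query_bound_le:
  assumes adm: "admissible \<rho> \<epsilon>"
  shows "query_bound \<rho> \<epsilon> \<le> 2 * 140000\<^sup>2 * (log_factor \<rho> \<epsilon>)\<^sup>2 * (\<rho> ^ 12 / \<epsilon> ^ 8)"
proof -
  define z where "z = 13000 * \<rho> ^ 4 / \<epsilon> ^ 3"
  define G where "G = \<rho> ^ 6 / \<epsilon> ^ 4"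
  define L where "L = log_factor \<rho> \<epsilon>"
  have pos: "0 < \<rho>" "\<rho> \<le> 1" "0 < \<epsilon>"
    using adm by (auto simp: admissible_def)
  note quot = admissible_quotients[OF adm]
  note size = sample_size_bounds[OF adm z_def]
  have L1: "1 \<le> L"
    unfolding L_def using pos by (rule log_factor_ge_1)
  have G0: "0 \<le> G"
    using pos by (simp add: G_def)
  have "8 * (13000 * (\<rho> ^ 4 / \<epsilon> ^ 3)) \<le> \<rho>\<^sup>2 / \<epsilon> * (13000 * (\<rho> ^ 4 / \<epsilon> ^ 3))"
    using quot pos by (intro mult_right_mono) auto
  also have "\<dots> = 13000 * G"
    unfolding G_def using pos by (simp add: field_simps eval_nat_numeral)
  finally have zG: "z \<le> 1625 * G"
    unfolding z_def by simp
  have lnz: "ln z \<le> 17 * L"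
  proof -
    have "z \<le> 2 ^ 14 * (2 + 1 / \<epsilon>) ^ 3"
    proof -
      have "z = 13000 * \<rho> ^ 4 * (1 / \<epsilon>) ^ 3"
        unfolding z_def by (simp add: power_divide)
      also have "\<dots> \<le> 2 ^ 14 * (2 + 1 / \<epsilon>) ^ 3"
        using pos power_le_one[of \<rho> 4] by (intro mult_mono power_mono) auto
      finally show ?thesis .
    qed
    then have "ln z \<le> ln (2 ^ 14 * (2 + 1 / \<epsilon>) ^ 3)"
      using size(5) pos by (subst ln_le_cancel_iff) (auto intro!: add_pos_pos)
    also have "\<dots> = ln (2 ^ 14) + ln ((2 + 1 / \<epsilon>) ^ 3)"
      using pos by (intro ln_mult_pos zero_less_power add_pos_pos) auto
    also have "ln (2 ^ 14) = 14 * ln (2 :: real)"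
      by (subst ln_realpow) simp_all
    also have "ln ((2 + 1 / \<epsilon>) ^ 3) = 3 * ln (2 + 1 / \<epsilon>)"
      using pos by (subst ln_realpow) (auto intro: add_pos_pos)
    also have "14 * ln 2 + 3 * ln (2 + 1 / \<epsilon>) \<le> 14 * L + 3 * L"
    proof -
      have "ln 2 \<le> L"
        using L1 ln_2_less_1 by linarith
      moreover have "ln (2 + 1 / \<epsilon>) \<le> L"
        unfolding L_def using pos by simp
      ultimately show ?thesis
        by (intro add_mono mult_left_mono) simp_all
    qed
    finally show ?thesis by simp
  qed
  have s: "real (sample_size \<rho> \<epsilon>) \<le> 140000 * L * G"
  proof -
    have "real (sample_size \<rho> \<epsilon>) \<le> 5 * z * ln z"
      by (rule size(4))
    also have "\<dots> \<le> 5 * (1625 * G) * (17 * L)"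
      using zG lnz size(1,5) G0 by (intro mult_mono) auto
    also have "\<dots> = 138125 * (L * G)"
      by simp
    also have "\<dots> \<le> 140000 * (L * G)"
      using G0 L1 by (intro mult_right_mono) auto
    also have "\<dots> = 140000 * L * G"
      by simp
    finally show ?thesis .
  qed
  have m: "real (small_order \<rho> \<epsilon>) \<le> 140000 * L * G"
  proof -
    have "real (small_order \<rho> \<epsilon>) \<le> 13 * (\<rho> / \<epsilon>) * 1"
      unfolding small_order_def using quot(2) by linarith
    also have "\<dots> \<le> 13 * (\<rho> / \<epsilon>) * ((\<rho>\<^sup>2 / \<epsilon>)\<^sup>2 * (\<rho> / \<epsilon>))"
    proof -
      have "1 * 1 \<le> (\<rho>\<^sup>2 / \<epsilon>)\<^sup>2 * (\<rho> / \<epsilon>)"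
        using quot by (intro mult_mono) auto
      then show ?thesis
        using pos by (intro mult_left_mono) auto
    qed
    also have "\<dots> = 13 * G"
      unfolding G_def using pos by (simp add: field_simps eval_nat_numeral)
    also have "\<dots> \<le> 140000 * L * G"
      using G0 L1 by (intro mult_right_mono) auto
    finally show ?thesis .
  qed
  have "query_bound \<rho> \<epsilon> \<le> (140000 * L * G)\<^sup>2 + (140000 * L * G)\<^sup>2"
    unfolding query_bound_def using s m by (intro add_mono power_mono) auto
  also have "\<dots> = 2 * 140000\<^sup>2 * L\<^sup>2 * G\<^sup>2"
    by (simp add: power_mult_distrib)
  also have "G\<^sup>2 = \<rho> ^ 12 / \<epsilon> ^ 8"
    by (simp add: G_def power_divide flip: power_mult)
  finally show ?thesis
    unfolding L_def .
qed

lemma eps_far_mono: "eps_far P \<epsilon> D \<Longrightarrow> \<epsilon>' \<le> \<epsilon> \<Longrightarrow> eps_far P \<epsilon>' D"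
  unfolding eps_far_def by fastforce

lemma two_sided_tester_mono:
  "two_sided_tester P \<epsilon>' A \<Longrightarrow> \<epsilon>' \<le> \<epsilon> \<Longrightarrow> two_sided_tester P \<epsilon> A"
  unfolding two_sided_tester_def using eps_far_mono by blast

text \<open>
  Replacing \<open>\<epsilon>\<close> by \<open>\<rho>\<^sup>2 / 8\<close> costs a constant factor only, since \<open>2 + 8 / \<rho>\<^sup>2 \<le> (2 + 1 / \<rho>) ^ 4\<close>.
\<close>

lemma log_factor_truncate:
  assumes "0 < \<rho>" "\<rho> \<le> 1" "0 < \<epsilon>"
  shows "log_factor \<rho> (min \<epsilon> (\<rho>\<^sup>2 / 8)) \<le> 5 * log_factor \<rho> \<epsilon>"
proof -
  have nonneg: "0 \<le> ln (2 + 1 / \<epsilon>)" "0 \<le> ln (2 + 1 / \<rho>)"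
    using assms by auto
  have "ln (2 + 1 / (\<rho>\<^sup>2 / 8)) \<le> 4 * ln (2 + 1 / \<rho>)"
  proof -
    define x where "x = 1 / \<rho>"
    have x: "1 \<le> x"
      using assms by (simp add: x_def)
    have "2 + 8 * x\<^sup>2 \<le> (2 + x) ^ 4"
    proof -
      have "9 \<le> (2 + x)\<^sup>2"
        using power_mono[of 3 "2 + x" 2] x by simp
      then have "9 * (2 + x)\<^sup>2 \<le> (2 + x)\<^sup>2 * (2 + x)\<^sup>2"
        by (intro mult_right_mono) auto
      moreover have "2 + 8 * x\<^sup>2 \<le> 9 * (2 + x)\<^sup>2"
        using x by (simp add: power2_sum)
      ultimately show ?thesis
        by (simp flip: power_add)
    qed
    then have "ln (2 + 8 * x\<^sup>2) \<le> ln ((2 + x) ^ 4)"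
      using x by (subst ln_le_cancel_iff) (auto intro: add_pos_nonneg)
    also have "\<dots> = 4 * ln (2 + x)"
      using x by (simp add: ln_realpow)
    finally show ?thesis
      by (simp add: x_def power_divide)
  qed
  then show ?thesis
    using nonneg by (auto simp: min_def)
qed

text \<open>
  A tester for a smaller proximity parameter also serves for a larger one; \<open>h\<close> truncates \<open>\<epsilon>\<close> to the
  admissible range.
\<close>

lemma admits_tester_admissible:
  assumes "\<And>\<epsilon>. \<epsilon> \<in> E \<Longrightarrow> admissible \<rho> (h \<epsilon>) \<and> h \<epsilon> \<le> \<epsilon>"
  shows "admits_tester (rho_dag \<rho> :: 'v pair_pre_digraph \<Rightarrow> bool) E (\<lambda>\<epsilon>. query_bound \<rho> (h \<epsilon>))"
  unfolding admits_tester_def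
  using assms
  by (intro exI[of _ "\<lambda>\<epsilon>. dag_tester \<rho> (h \<epsilon>)"])
     (auto intro: size_oblivious_dag_tester query_complexity_dag_tester two_sided_tester_mono
        two_sided_tester_dag_tester)

lemma query_bound_nonneg: "0 \<le> query_bound \<rho> \<epsilon>"
  by (simp add: query_bound_def)

theorem theorem6p2:
  shows "(\<exists>c \<in> soft_O {(\<rho>, \<epsilon>). 0 < \<rho> \<and> \<rho> \<le> 1 \<and> 0 < \<epsilon> \<and> \<epsilon> \<le> \<rho>\<^sup>2 / 8}
             (\<lambda>\<rho> \<epsilon>. \<rho> ^ 12 / \<epsilon> ^ 8).
           \<forall>\<rho>. 0 < \<rho> \<and> \<rho> \<le> 1 \<longrightarrow>
             admits_tester (rho_dag \<rho> :: 'v pair_pre_digraph \<Rightarrow> bool)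
               {\<epsilon>. 0 < \<epsilon> \<and> \<epsilon> \<le> \<rho>\<^sup>2 / 8} (c \<rho>)) \<and>
         (\<exists>c \<in> soft_O {(\<rho>, \<epsilon>). 0 < \<rho> \<and> \<rho> \<le> 1 \<and> 0 < \<epsilon>}
             (\<lambda>\<rho> \<epsilon>. \<rho> ^ 12 / (min \<epsilon> (\<rho>\<^sup>2)) ^ 8).
           \<forall>\<rho>. 0 < \<rho> \<and> \<rho> \<le> 1 \<longrightarrow>
             admits_tester (rho_dag \<rho> :: 'v pair_pre_digraph \<Rightarrow> bool)
               {\<epsilon>. 0 < \<epsilon>} (c \<rho>))"
proof (intro conjI bexI allI impI)
  fix \<rho> :: real
  assume \<rho>: "0 < \<rho> \<and> \<rho> \<le> 1"
  show "admits_tester (rho_dag \<rho> :: 'v pair_pre_digraph \<Rightarrow> bool)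
      {\<epsilon>. 0 < \<epsilon> \<and> \<epsilon> \<le> \<rho>\<^sup>2 / 8} (\<lambda>\<epsilon>. query_bound \<rho> \<epsilon>)"
    by (rule admits_tester_admissible[where h = "\<lambda>\<epsilon>. \<epsilon>"]) (use \<rho> in \<open>auto simp: admissible_def\<close>)
  show "admits_tester (rho_dag \<rho> :: 'v pair_pre_digraph \<Rightarrow> bool)
      {\<epsilon>. 0 < \<epsilon>} (\<lambda>\<epsilon>. query_bound \<rho> (min \<epsilon> (\<rho>\<^sup>2 / 8)))"
    by (rule admits_tester_admissible) (use \<rho> in \<open>auto simp: admissible_def\<close>)
next
  have "\<bar>query_bound \<rho> \<epsilon>\<bar> \<le> 2 * 140000\<^sup>2 * (log_factor \<rho> \<epsilon>)\<^sup>2 * \<bar>\<rho> ^ 12 / \<epsilon> ^ 8\<bar>"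
    if "admissible \<rho> \<epsilon>" for \<rho> \<epsilon> :: real
    using query_bound_le[OF that] that
    by (simp add: query_bound_nonneg abs_of_nonneg admissible_def)
  then show "query_bound \<in> soft_O {(\<rho>, \<epsilon>). 0 < \<rho> \<and> \<rho> \<le> 1 \<and> 0 < \<epsilon> \<and> \<epsilon> \<le> \<rho>\<^sup>2 / 8}
      (\<lambda>\<rho> \<epsilon>. \<rho> ^ 12 / \<epsilon> ^ 8)"
    unfolding soft_O_def mem_Collect_eq admissible_def
    by (intro exI[of _ "2 * 140000\<^sup>2 :: real"] exI[of _ "2 :: nat"]) auto
next
  have "\<bar>query_bound \<rho> (min \<epsilon> (\<rho>\<^sup>2 / 8))\<bar> \<le>
      2 * 140000\<^sup>2 * 5\<^sup>2 * 8 ^ 8 * (log_factor \<rho> \<epsilon>)\<^sup>2 * \<bar>\<rho> ^ 12 / (min \<epsilon> (\<rho>\<^sup>2)) ^ 8\<bar>"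
    if "0 < \<rho>" "\<rho> \<le> 1" "0 < \<epsilon>" for \<rho> \<epsilon> :: real
  proof -
    let ?\<epsilon> = "min \<epsilon> (\<rho>\<^sup>2 / 8)" and ?\<mu> = "min \<epsilon> (\<rho>\<^sup>2)"
    have adm: "admissible \<rho> ?\<epsilon>"
      using that by (simp add: admissible_def)
    have \<mu>: "0 < ?\<mu>" "?\<mu> / 8 \<le> ?\<epsilon>"
      using that by (auto simp: min_def)
    have "query_bound \<rho> ?\<epsilon> \<le> 2 * 140000\<^sup>2 * (log_factor \<rho> ?\<epsilon>)\<^sup>2 * (\<rho> ^ 12 / ?\<epsilon> ^ 8)"
      by (rule query_bound_le[OF adm])
    also have "\<dots> \<le> 2 * 140000\<^sup>2 * (5 * log_factor \<rho> \<epsilon>)\<^sup>2 * (\<rho> ^ 12 / (?\<mu> / 8) ^ 8)"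
    proof (intro mult_mono power_mono divide_left_mono)
      show "log_factor \<rho> ?\<epsilon> \<le> 5 * log_factor \<rho> \<epsilon>"
        using that by (rule log_factor_truncate)
      show "0 \<le> log_factor \<rho> ?\<epsilon>"
        using log_factor_ge_1[of \<rho> ?\<epsilon>] that by simp
    qed (use that \<mu> in \<open>auto intro!: mult_pos_pos zero_less_power divide_nonneg_nonneg\<close>)
    also have "\<dots> = 2 * 140000\<^sup>2 * 5\<^sup>2 * 8 ^ 8 * (log_factor \<rho> \<epsilon>)\<^sup>2 * (\<rho> ^ 12 / ?\<mu> ^ 8)"
      by (simp only: power_mult_distrib power_divide) simp
    finally show ?thesis
      using \<mu>(1) that by (simp add: query_bound_nonneg abs_of_nonneg)
  qed
  then show "(\<lambda>\<rho> \<epsilon>. query_bound \<rho> (min \<epsilon> (\<rho>\<^sup>2 / 8))) \<in>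
      soft_O {(\<rho>, \<epsilon>). 0 < \<rho> \<and> \<rho> \<le> 1 \<and> 0 < \<epsilon>} (\<lambda>\<rho> \<epsilon>. \<rho> ^ 12 / (min \<epsilon> (\<rho>\<^sup>2)) ^ 8)"
    unfolding soft_O_def mem_Collect_eq
    by (intro exI[of _ "2 * 140000\<^sup>2 * 5\<^sup>2 * 8 ^ 8 :: real"] exI[of _ "2 :: nat"]) auto
qed

end
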